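(* Let $[a,b]\subset\mathbb{R}$ be a bounded segment. Suppose $f$ is analytic in a complex domain $\mathcal D\supset[a,b]$, and $\operatorname{dist}([a,b],\partial\mathcal D)>\rho>0$. Let $x_1,x_2,\ldots$ be a sequence of distinct nodes in $[a,b]$, and for each $n\ge 1$ let $I_n$ denote the interpolation operator with nodes $x_1,\ldots,x_n$ of one (fixed) of the three types: exponential $I^{\mathrm e}_{\{x_k,t_k\}_{k=1}^n}$ with a sequence $t_1,t_2,\ldots$ of distinct real numbers, Gaussian $I^{\mathrm g}_{\{x_k\}_{k=1}^n}$, or polynomial $I^{\mathrm p}_{\{x_k\}_{k=1}^n}$. In the case of $I^{\mathrm e}$ assume additionally that there exists $R$ such that $|t_k|<R$ for all $k$. Then for all $n$ $$\sup_{x\in[a,b]}|f(x)-I_nf(x)|\le c\Big(\frac{b-a}{\rho}\Big)^n$$ with some constant $c=c(f,a,b,\rho,R)$ depending only on $f,a,b,\rho$ and (in the case of $I^{\mathrm e}$) $R$.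
   Context: For distinct nodes $x_1,\ldots,x_n\in\mathbb{R}$ and basis functions $f_1,\ldots,f_n$ with $\det(f_k(x_l))_{k,l=1}^n\neq0$, the interpolant of $f$ is the unique linear combination $\sum_{k=1}^nc_kf_k$ that agrees with $f$ at $x_1,\ldots,x_n$. The three types are: - exponential interpolation $I^{\mathrm e}_{\{x_k,t_k\}_{k=1}^n}$ (for distinct $t_1,\ldots,t_n\in\mathbb{R}$): $f_k(x)=e^{t_kx}$; - Gaussian RBF interpolation $I^{\mathrm g}_{\{x_k\}_{k=1}^n}$: $f_k(x)=e^{-(x-x_k)^2/2}$; - polynomial interpolation $I^{\mathrm p}_{\{x_k\}_{k=1}^n}$: $f_k(x)=x^{k-1}$. In all three cases the interpolation matrix is nondegenerate, so the interpolant is well defined. *)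

theory Defs
  imports "HOL-Complex_Analysis.Complex_Analysis"
begin

(* Distance between two sets. The library's setdist is 0 when one of the sets is
   empty; here it is infinity, so that for an entire function (domain UNIV, with empty
   frontier) the distance to the boundary exceeds every rho. *)
definition ext_setdist :: "complex set \<Rightarrow> complex set \<Rightarrow> ereal" where
  "ext_setdist S T = (if S = {} \<or> T = {} then \<infinity> else ereal (setdist S T))"

(* Sequences are indexed from 0: the n nodes are x 0, ..., x (n - 1), and the n basis
   functions are \<phi> 0, ..., \<phi> (n - 1). The interpolated function may take complex values,
   so the coefficients are complex. *)
definition interpolant ::
  "nat \<Rightarrow> (nat \<Rightarrow> real) \<Rightarrow> (nat \<Rightarrow> real \<Rightarrow> real) \<Rightarrow> (real \<Rightarrow> complex) \<Rightarrow> real \<Rightarrow> complex" where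
  "interpolant n x \<phi> f =
     (THE g. (\<exists>c :: nat \<Rightarrow> complex. g = (\<lambda>y. \<Sum>k<n. c k * of_real (\<phi> k y))) \<and>
             (\<forall>l<n. g (x l) = f (x l)))"

definition exp_interpolant ::
  "(nat \<Rightarrow> real) \<Rightarrow> (nat \<Rightarrow> real) \<Rightarrow> nat \<Rightarrow> (real \<Rightarrow> complex) \<Rightarrow> real \<Rightarrow> complex" where
  "exp_interpolant x t n = interpolant n x (\<lambda>k y. exp (t k * y))"

definition gauss_interpolant ::
  "(nat \<Rightarrow> real) \<Rightarrow> nat \<Rightarrow> (real \<Rightarrow> complex) \<Rightarrow> real \<Rightarrow> complex" where
  "gauss_interpolant x n = interpolant n x (\<lambda>k y. exp (- ((y - x k)\<^sup>2 / 2)))"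

definition poly_interpolant ::
  "(nat \<Rightarrow> real) \<Rightarrow> nat \<Rightarrow> (real \<Rightarrow> complex) \<Rightarrow> real \<Rightarrow> complex" where
  "poly_interpolant x n = interpolant n x (\<lambda>k y. y ^ k)"

(* The supremum is taken in ereal, so a bound on it includes boundedness. *)
definition sup_error :: "real \<Rightarrow> real \<Rightarrow> (real \<Rightarrow> complex) \<Rightarrow> (real \<Rightarrow> complex) \<Rightarrow> ereal" where
  "sup_error a b f g = (SUP y\<in>{a..b}. ereal (norm (f y - g y)))"

end

theory Submission
  imports Defs "Jordan_Normal_Form.Determinant"
begin

text \<open>
  All three errors are estimated by real-variable arguments. Let \<open>L\<close> be the product of the operators
  \<open>d/dy - t\<^sub>i\<close> (all \<open>t\<^sub>i = 0\<close> for polynomials), which annihilates the interpolants. If \<open>b\<close> vanishes at the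
  nodes and \<open>L b = \<gamma>\<close> is a nonzero constant, then the difference of the error \<open>e\<close> and the multiple of
  \<open>b\<close> agreeing with it at \<open>x\<close> has \<open>n + 1\<close> zeros, and Rolle's theorem gives
  \<open>\<bar>e x\<bar> \<le> \<bar>b x\<bar> sup \<bar>L f\<bar> / \<bar>\<gamma>\<bar>\<close>. Cauchy's estimates bound \<open>\<bar>L f\<bar>\<close> by a constant times \<open>n! / \<rho>\<^sup>n\<close>.

  For polynomials \<open>b\<close> is the node polynomial. For exponentials, after multiplication by an exponential
  all \<open>t\<^sub>i\<close> are negative, and \<open>b\<close> is the \<open>(n + 1)\<close>-dimensional determinant with entries \<open>exp (t\<^sub>i x\<^sub>j)\<close>
  bordered by a row of ones. Subtracting neighbouring columns and writing the differences as integrals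
  reduces its size to that of \<open>det exp (t\<^sub>i y\<^sub>j)\<close> at points \<open>y\<close> interlacing the nodes. Divided by the
  Vandermonde determinant this is log-Lipschitz in each \<open>y\<^sub>j\<close>, again by Rolle's theorem, but applied in the
  exponent variable; the interlacing keeps the total displacement below \<open>b - a\<close>, uniformly in \<open>n\<close>.

  Gaussian interpolation is exponential interpolation of \<open>f(y) exp (y\<^sup>2 / 2)\<close> with exponents \<open>t\<^sub>i = x\<^sub>i\<close>.
\<close>

section \<open>Rolle's theorem for products of first-order operators\<close>

text \<open>The operator d/dy - t, acting not on a function but on the sequence \<open>a k\<close>
  of its k-th derivatives at one fixed point. The value of a whole product of such operators at that
  point is \<open>sdiffs ts a 0\<close>.\<close>

definition sdiff :: "real \<Rightarrow> (nat \<Rightarrow> 'a::real_vector) \<Rightarrow> nat \<Rightarrow> 'a" where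
  "sdiff t a = (\<lambda>k. a (Suc k) - t *\<^sub>R a k)"

definition sdiffs :: "real list \<Rightarrow> (nat \<Rightarrow> 'a::real_vector) \<Rightarrow> nat \<Rightarrow> 'a" where
  "sdiffs ts = fold sdiff ts"

lemma sdiffs_Nil [simp]: "sdiffs [] a = a"
  and sdiffs_Cons [simp]: "sdiffs (t # ts) a = sdiffs ts (sdiff t a)"
  by (simp_all add: sdiffs_def)

lemma sdiffs_linear_image:
  assumes "linear h"
  shows "sdiffs ts (\<lambda>k. h (a k)) = (\<lambda>k. h (sdiffs ts a k))"
proof (induction ts arbitrary: a)
  case (Cons t ts)
  have "sdiff t (\<lambda>k. h (a k)) = (\<lambda>k. h (sdiff t a k))"
    by (simp add: sdiff_def linear_diff[OF assms] linear_scale[OF assms])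
  then show ?case by (simp add: Cons)
qed simp

lemma sdiffs_diff:
  "sdiffs ts (\<lambda>k. a k - b k) = (\<lambda>k. sdiffs ts a k - sdiffs ts b k)"
proof (induction ts arbitrary: a b)
  case (Cons t ts)
  have "sdiff t (\<lambda>k. a k - b k) = (\<lambda>k. sdiff t a k - sdiff t b k)"
    by (simp add: sdiff_def algebra_simps)
  then show ?case by (simp add: Cons)
qed simp

lemma sdiffs_scale:
  fixes a :: "nat \<Rightarrow> real"
  shows "sdiffs ts (\<lambda>k. c * a k) = (\<lambda>k. c * sdiffs ts a k)"
  by (rule sdiffs_linear_image) (simp add: linear_times)

lemma sdiffs_sum:
  assumes "finite I"
  shows "sdiffs ts (\<lambda>k. \<Sum>i\<in>I. a i k) = (\<lambda>k. \<Sum>i\<in>I. sdiffs ts (a i) k)"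
proof (induction ts arbitrary: a)
  case (Cons t ts)
  have "sdiff t (\<lambda>k. \<Sum>i\<in>I. a i k) = (\<lambda>k. \<Sum>i\<in>I. sdiff t (a i) k)"
    by (simp add: sdiff_def sum_subtractf scaleR_sum_right)
  then show ?case by (simp add: Cons)
qed simp

text \<open>The derivatives of a multiple of exp (s y) form a geometric sequence with ratio
  \<open>s\<close>, an eigenvector of each \<open>sdiff t\<close> with eigenvalue
  \<open>s - t\<close>. Exponentials whose exponent occurs in \<open>ts\<close> are therefore
  annihilated.\<close>

lemma sdiffs_geometric:
  fixes s c :: real
  shows "sdiffs ts (\<lambda>k. c * s ^ k) = (\<lambda>k. (\<Prod>t\<leftarrow>ts. s - t) * c * s ^ k)"
proof (induction ts arbitrary: c)
  case (Cons t ts)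
  have "sdiff t (\<lambda>k. c * s ^ k) = (\<lambda>k. ((s - t) * c) * s ^ k)"
    by (simp add: sdiff_def algebra_simps)
  then have "sdiffs (t # ts) (\<lambda>k. c * s ^ k) = (\<lambda>k. (\<Prod>t\<leftarrow>ts. s - t) * ((s - t) * c) * s ^ k)"
    by (simp only: sdiffs_Cons Cons)
  then show ?case by (simp add: mult_ac)
qed simp

lemma sdiffs_replicate_0: "sdiffs (replicate n 0) a k = a (n + k)"
  by (induction n arbitrary: a) (simp_all add: sdiff_def)

section \<open>Functions carried with all their derivatives, and Rolle's theorem\<close>

definition deriv_chain :: "real set \<Rightarrow> (nat \<Rightarrow> real \<Rightarrow> real) \<Rightarrow> bool" where
  "deriv_chain S u \<longleftrightarrow> (\<forall>k. \<forall>y\<in>S. (u k has_real_derivative u (Suc k) y) (at y))"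

lemma deriv_chain_diff:
  "deriv_chain S u \<Longrightarrow> deriv_chain S v \<Longrightarrow> deriv_chain S (\<lambda>k y. u k y - v k y)"
  unfolding deriv_chain_def by (auto intro!: derivative_intros)

lemma deriv_chain_scale:
  "deriv_chain S u \<Longrightarrow> deriv_chain S (\<lambda>k y. c * u k y)"
  unfolding deriv_chain_def by (auto intro!: derivative_eq_intros)

lemma deriv_chain_sum:
  "(\<And>i. i \<in> I \<Longrightarrow> deriv_chain S (u i)) \<Longrightarrow> deriv_chain S (\<lambda>k y. \<Sum>i\<in>I. u i k y)"
  unfolding deriv_chain_def by (auto intro!: DERIV_sum)

lemma deriv_chain_exp: "deriv_chain S (\<lambda>k y. exp (s * y) * s ^ k)"
  unfolding deriv_chain_def by (auto intro!: derivative_eq_intros)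

lemma deriv_chain_poly: "deriv_chain S (\<lambda>k. poly ((pderiv ^^ k) p))"
  unfolding deriv_chain_def by (simp add: poly_DERIV)

lemma rolle_finite_zeros:
  fixes w w' :: "real \<Rightarrow> real"
  assumes "finite Z" "card Z = Suc n" "Z \<subseteq> {\<alpha>..\<beta>}"
    and "\<And>z. z \<in> Z \<Longrightarrow> w z = 0"
    and "\<And>y. y \<in> {\<alpha>..\<beta>} \<Longrightarrow> (w has_real_derivative w' y) (at y)"
  obtains Z' where "finite Z'" "card Z' = n" "Z' \<subseteq> {\<alpha>..Max Z}"
    "\<And>z. z \<in> Z' \<Longrightarrow> w' z = 0"
proof -
  \<comment> \<open>The half-open interval strengthens the induction: the zeros found earlier lie
    below the second largest zero \<open>l\<close>, so the one that Rolle's theorem gives between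
    \<open>l\<close> and \<open>m\<close> is new.\<close>
  have "\<exists>Z'. finite Z' \<and> card Z' = n \<and> Z' \<subseteq> {\<alpha>..<Max Z} \<and> (\<forall>z\<in>Z'. w' z = 0)"
    using assms(1-4)
  proof (induction n arbitrary: Z)
    case 0
    then show ?case by (intro exI[of _ "{}"]) auto
  next
    case (Suc n)
    define m where "m = Max Z"
    define Y where "Y = Z - {m}"
    have "Z \<noteq> {}" using Suc.prems by auto
    then have m: "m \<in> Z" using Suc.prems by (simp add: m_def)
    have Y: "finite Y" "card Y = Suc n" "Y \<subseteq> {\<alpha>..\<beta>}" "\<And>z. z \<in> Y \<Longrightarrow> w z = 0"
      using Suc.prems m by (auto simp: Y_def)
    then have "Y \<noteq> {}" by auto
    define l where "l = Max Y"
    have l: "l \<in> Y" using Y \<open>Y \<noteq> {}\<close> by (simp add: l_def)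
    have "l < m"
      using l Suc.prems(1) by (metis Y_def DiffE Max_ge insertI1 less_eq_real_def m_def)
    obtain V where V: "finite V" "card V = n" "V \<subseteq> {\<alpha>..<l}" "\<forall>z\<in>V. w' z = 0"
      using Suc.IH[OF Y] l_def by auto
    have D: "(w has_real_derivative w' y) (at y)" if "l \<le> y" "y \<le> m" for y
      using that assms(5) Y(3) l m Suc.prems(3) by fastforce
    have "w l = w m" using l m Y Suc.prems by auto
    then obtain z where z: "l < z" "z < m" "w' z = 0"
      using MVT2[OF \<open>l < m\<close>, of w w'] D \<open>l < m\<close> by auto
    have "z \<notin> V" using z V by auto
    then have "card (insert z V) = Suc n" using V by simp
    moreover have "insert z V \<subseteq> {\<alpha>..<Max Z}"
      using V z Y(3) l by (auto simp: m_def[symmetric])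
    ultimately show ?case using V z by (intro exI[of _ "insert z V"]) auto
  qed
  then obtain Z' where "finite Z'" "card Z' = n" "Z' \<subseteq> {\<alpha>..<Max Z}" "\<forall>z\<in>Z'. w' z = 0" by blast
  then show ?thesis by (intro that[of Z']) auto
qed

text \<open>The integrating factor exp (- t y) makes u' - t u a nonvanishing multiple of the
  derivative of exp (- t y) u. By Rolle's theorem each operator costs one zero, so one zero survives
  all of them.\<close>

lemma sdiffs_mean_value:
  assumes "deriv_chain {\<alpha>..\<beta>} u" "finite Z" "card Z = Suc (length ts)" "Z \<subseteq> {\<alpha>..\<beta>}"
    and "\<And>z. z \<in> Z \<Longrightarrow> u 0 z = 0"
  obtains \<xi> where "\<xi> \<in> {\<alpha>..\<beta>}" "sdiffs ts (\<lambda>k. u k \<xi>) 0 = 0"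
proof -
  have "\<exists>\<xi>\<in>{\<alpha>..\<beta>}. sdiffs ts (\<lambda>k. u k \<xi>) 0 = 0"
    using assms
  proof (induction ts arbitrary: u Z)
    case Nil
    then obtain z where "Z = {z}" by (auto simp: card_1_singleton_iff)
    then show ?case using Nil by auto
  next
    case (Cons t ts)
    define v where "v k y = sdiff t (\<lambda>k. u k y) k" for k y
    have v: "deriv_chain {\<alpha>..\<beta>} v"
      using Cons.prems(1) unfolding deriv_chain_def v_def sdiff_def
      by (auto intro!: derivative_eq_intros)
    have D: "((\<lambda>y. exp (- t * y) * u 0 y) has_real_derivative exp (- t * y) * v 0 y) (at y)"
      if "y \<in> {\<alpha>..\<beta>}" for y
      using Cons.prems(1) that unfolding deriv_chain_def v_def sdiff_def
      by (auto intro!: derivative_eq_intros simp: algebra_simps)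
    obtain Z' where Z': "finite Z'" "card Z' = Suc (length ts)" "Z' \<subseteq> {\<alpha>..Max Z}"
        "\<And>z. z \<in> Z' \<Longrightarrow> exp (- t * z) * v 0 z = 0"
      by (rule rolle_finite_zeros[OF Cons.prems(2) _ Cons.prems(4) _ D]) (use Cons.prems in auto)
    have "Max Z \<le> \<beta>"
    proof -
      have "Z \<noteq> {}" using Cons.prems by auto
      then show ?thesis using Max_in[OF Cons.prems(2)] Cons.prems(4) by auto
    qed
    then have "Z' \<subseteq> {\<alpha>..\<beta>}" using Z' by auto
    with Cons.IH[OF v Z'(1,2)] Z'(4) show ?case
      by (auto simp: v_def)
  qed
  then show ?thesis using that by blast
qed

section \<open>Growth of the operator product\<close>

text \<open>Expanding the product gives at most the sum over j of \<open>n choose j\<close> times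
  \<open>R ^ j\<close> times the bound on the term of order \<open>n - j\<close>. Since the binomial
  coefficient times (n - j)! is n! / j!, what remains beside the bound for order \<open>n\<close> is
  a partial sum of the series of \<open>exp (R * \<rho>)\<close>, so the growth rate in
  \<open>n\<close> is unaffected.\<close>

lemma sdiffs_bound:
  fixes F :: "nat \<Rightarrow> 'a::real_normed_vector"
  assumes \<rho>: "\<rho> > 0" and M: "\<And>k. norm (F k) \<le> M * fact k / \<rho> ^ k"
    and R: "\<And>t. t \<in> set ts \<Longrightarrow> \<bar>t\<bar> \<le> R" and "R \<ge> 0"
  shows "norm (sdiffs ts F 0) \<le> M * exp (R * \<rho>) * fact (length ts) / \<rho> ^ length ts"
proof -
  have "M \<ge> 0" using M[of 0] norm_ge_zero[of "F 0"] by (simp del: norm_ge_zero)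
  \<comment> \<open>\<open>h m k\<close> is the bound after \<open>m\<close> applications of \<open>sdiff\<close>; \<open>h (Suc m) k = h m (Suc k) + R * h m k\<close> by Pascal's rule.\<close>
  define h where "h m k = (\<Sum>j\<le>m. real (m choose j) * R ^ j * (M * fact (m - j + k) / \<rho> ^ (m - j + k)))" for m k
  define q where "q j = M * fact j / \<rho> ^ j" for j :: nat
  have h_Suc: "h (Suc m) k = h m (Suc k) + R * h m k" for m k
  proof -
    have 1: "h (Suc m) k = q (Suc m + k) + (\<Sum>j\<le>m. real (Suc m choose Suc j) * R ^ Suc j * q (m - j + k))"
      unfolding h_def q_def by (subst sum.atMost_Suc_shift) simp
    have 2: "h m (Suc k) = (\<Sum>j\<le>Suc m. real (m choose j) * R ^ j * q (Suc m - j + k))"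
      unfolding h_def q_def by (simp add: Suc_diff_le)
    have 3: "\<dots> = q (Suc m + k) + (\<Sum>j\<le>m. real (m choose Suc j) * R ^ Suc j * q (m - j + k))"
      by (subst sum.atMost_Suc_shift) simp
    have 4: "R * h m k = (\<Sum>j\<le>m. real (m choose j) * R ^ Suc j * q (m - j + k))"
      unfolding h_def q_def by (simp add: sum_distrib_left mult_ac)
    show ?thesis unfolding 1 2 3 4 by (simp add: sum.distrib[symmetric] algebra_simps)
  qed
  have *: "norm (sdiffs ts F k) \<le> h (m + length ts) k"
    if "\<And>k. norm (F k) \<le> h m k" "\<And>t. t \<in> set ts \<Longrightarrow> \<bar>t\<bar> \<le> R" for m k ts and F :: "nat \<Rightarrow> 'a"
    using that
  proof (induction ts arbitrary: F m)
    case (Cons t ts)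
    have "norm (sdiff t F k) \<le> h (Suc m) k" for k
    proof -
      have "norm (sdiff t F k) \<le> norm (F (Suc k)) + \<bar>t\<bar> * norm (F k)"
        unfolding sdiff_def by (rule norm_triangle_ineq4[THEN order_trans]) simp
      also have "\<dots> \<le> h m (Suc k) + R * h m k"
        using Cons.prems by (intro add_mono mult_mono) (auto simp: order_trans[OF norm_ge_zero] \<open>R \<ge> 0\<close>)
      finally show ?thesis by (simp add: h_Suc)
    qed
    then have "norm (sdiffs ts (sdiff t F) k) \<le> h (Suc m + length ts) k"
      by (intro Cons.IH) (use Cons.prems in auto)
    then show ?case by simp
  qed simp
  define n where "n = length ts"
  have "norm (sdiffs ts F 0) \<le> h (0 + n) 0"
    unfolding n_def by (rule *) (use M R in \<open>auto simp: h_def\<close>)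
  also have "h (0 + n) 0 = (\<Sum>j\<le>n. M * fact n / \<rho> ^ n * ((R * \<rho>) ^ j / fact j))"
    unfolding h_def
  proof (rule sum.cong)
    fix j assume "j \<in> {..n}"
    then have j: "j \<le> n" by simp
    have "\<rho> ^ n = \<rho> ^ (n - j) * \<rho> ^ j" using j by (simp flip: power_add)
    then show "real (0 + n choose j) * R ^ j * (M * fact (0 + n - j + 0) / \<rho> ^ (0 + n - j + 0))
        = M * fact n / \<rho> ^ n * ((R * \<rho>) ^ j / fact j)"
      using \<rho> by (simp add: binomial_fact[OF j] power_mult_distrib field_simps)
  qed simp
  also have "\<dots> = M * fact n / \<rho> ^ n * (\<Sum>j\<le>n. (R * \<rho>) ^ j / fact j)"
    by (simp add: sum_distrib_left)
  also have "\<dots> \<le> M * fact n / \<rho> ^ n * exp (R * \<rho>)"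
  proof (rule mult_left_mono)
    have "summable (\<lambda>j. (R * \<rho>) ^ j / fact j)" using summable_exp[of "R * \<rho>"] by (simp add: field_simps)
    moreover have "exp (R * \<rho>) = (\<Sum>j. (R * \<rho>) ^ j / fact j)" by (simp add: exp_def divide_inverse mult.commute)
    ultimately show "(\<Sum>j\<le>n. (R * \<rho>) ^ j / fact j) \<le> exp (R * \<rho>)"
      using \<open>R \<ge> 0\<close> \<rho> by (metis (no_types, lifting) sum_le_suminf finite_atMost divide_nonneg_nonneg fact_ge_zero less_imp_le mult_nonneg_nonneg zero_le_power)
    show "0 \<le> M * fact n / \<rho> ^ n" using \<open>M \<ge> 0\<close> \<rho> by simp
  qed
  finally show ?thesis by (simp add: n_def mult_ac)
qed

section \<open>Determinants given by their columns\<close>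

text \<open>Column-first indexing, \<open>a j\<close> being the \<open>j\<close>-th column: replacing a node is then the update \<open>a(j := c)\<close>.\<close>

definition gdet :: "nat \<Rightarrow> (nat \<Rightarrow> nat \<Rightarrow> 'a::comm_ring_1) \<Rightarrow> 'a" where
  "gdet n a = Determinant.det (Matrix.mat n n (\<lambda>(i, j). a j i))"

text \<open>The cofactors of column \<open>k\<close>, listed by row \<open>i\<close>. They do not
  involve column \<open>k\<close> itself, so the expansion along that column is linear in whatever
  is put there.\<close>

definition gcof :: "nat \<Rightarrow> (nat \<Rightarrow> nat \<Rightarrow> 'a::comm_ring_1) \<Rightarrow> nat \<Rightarrow> nat \<Rightarrow> 'a" where
  "gcof n a k i = cofactor (Matrix.mat n n (\<lambda>(i, j). a j i)) i k"

text \<open>The increasing enumeration of the naturals other than \<open>k\<close>; it indexes the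
  rows and columns of a minor.\<close>

definition skip :: "nat \<Rightarrow> nat \<Rightarrow> nat" where
  "skip k j = (if j < k then j else Suc j)"

lemma gdet_cong:
  assumes "\<And>i j. i < n \<Longrightarrow> j < n \<Longrightarrow> a j i = b j i"
  shows "gdet n a = gdet n b"
proof -
  have "Matrix.mat n n (\<lambda>(i, j). a j i) = Matrix.mat n n (\<lambda>(i, j). b j i)"
    using assms by (intro eq_matI) auto
  then show ?thesis by (simp add: gdet_def)
qed

lemma gcof_Suc:
  assumes "i < Suc n" "k < Suc n"
  shows "gcof (Suc n) a k i = (- 1) ^ (i + k) * gdet n (\<lambda>j i'. a (skip k j) (skip i i'))"
proof -
  have "mat_delete (Matrix.mat (Suc n) (Suc n) (\<lambda>(i, j). a j i)) i k
      = Matrix.mat n n (\<lambda>(i', j). a (skip k j) (skip i i'))"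
    using assms unfolding mat_delete_def skip_def by (intro eq_matI) auto
  then show ?thesis by (simp add: gcof_def cofactor_def gdet_def)
qed

lemma gdet_column_expansion:
  assumes "k < n"
  shows "gdet n (a(k := c)) = (\<Sum>i<n. c i * gcof n a k i)"
proof -
  let ?A = "Matrix.mat n n (\<lambda>(i, j). (a(k := c)) j i)"
  have del: "mat_delete ?A i k = mat_delete (Matrix.mat n n (\<lambda>(i, j). a j i)) i k" if "i < n" for i
    unfolding mat_delete_def by (intro eq_matI) (use assms that in auto)
  have "Determinant.det ?A = (\<Sum>i<n. ?A $$ (i, k) * cofactor ?A i k)"
    by (rule laplace_expansion_column) (use assms in auto)
  also have "\<dots> = (\<Sum>i<n. c i * gcof n a k i)"
    by (rule sum.cong) (use assms del in \<open>auto simp: gcof_def cofactor_def\<close>)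
  finally show ?thesis by (simp add: gdet_def)
qed

lemma gdet_expansion:
  assumes "k < n"
  shows "gdet n a = (\<Sum>i<n. a k i * gcof n a k i)"
  using gdet_column_expansion[OF assms, of a "a k"] by simp

lemma gdet_identical_columns:
  assumes "j \<noteq> k" "j < n" "k < n" "\<And>i. i < n \<Longrightarrow> a j i = a k i"
  shows "gdet n a = 0"
  unfolding gdet_def
  by (rule det_identical_columns[of _ n j k]) (use assms in \<open>auto intro!: eq_vecI\<close>)

text \<open>The sum expands the determinant in which column \<open>k\<close> is overwritten by
  column \<open>j\<close>, so that two columns coincide. It is the source of the zeros of functions
  built from cofactors.\<close>

lemma gcof_orthogonal:
  assumes "j \<noteq> k" "j < n" "k < n"
  shows "(\<Sum>i<n. a j i * gcof n a k i) = 0"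
  using gdet_column_expansion[OF \<open>k < n\<close>, of a "a j"]
    gdet_identical_columns[of j k n "a(k := a j)"] assms by simp

text \<open>Cramer's rule: by orthogonality only the \<open>k\<close>-th term of the combination
  contributes.\<close>

lemma gdet_column_combination:
  assumes "k < n" "\<And>i. i < n \<Longrightarrow> c i = (\<Sum>j<n. d j * a j i)"
  shows "gdet n (a(k := c)) = d k * gdet n a"
proof -
  have "gdet n (a(k := c)) = (\<Sum>i<n. (\<Sum>j<n. d j * a j i) * gcof n a k i)"
    using assms by (simp add: gdet_column_expansion)
  also have "\<dots> = (\<Sum>j<n. d j * (\<Sum>i<n. a j i * gcof n a k i))"
    unfolding sum_distrib_right sum_distrib_left by (subst sum.swap) (simp add: mult.assoc)
  also have "\<dots> = (\<Sum>j<n. if j = k then d k * gdet n a else 0)"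
    by (rule sum.cong) (use assms in \<open>auto simp: gcof_orthogonal gdet_expansion[OF \<open>k < n\<close>, of a]\<close>)
  finally show ?thesis using assms by (simp add: sum.delta)
qed

lemma gdet_eq_0_imp_dependent:
  fixes a :: "nat \<Rightarrow> nat \<Rightarrow> 'a::field"
  assumes "gdet n a = 0"
  obtains d k where "k < n" "d k \<noteq> 0" "\<And>i. i < n \<Longrightarrow> (\<Sum>j<n. d j * a j i) = 0"
proof -
  let ?A = "Matrix.mat n n (\<lambda>(i, j). a j i)"
  obtain v where v: "v \<in> carrier_vec n" "v \<noteq> 0\<^sub>v n" "?A *\<^sub>v v = 0\<^sub>v n"
    using det_0_iff_vec_prod_zero_field[of ?A n] assms by (auto simp: gdet_def)
  obtain k where k: "k < n" "vec_index v k \<noteq> 0"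
    using v by (metis eq_vecI carrier_vecD index_zero_vec)
  have "(\<Sum>j<n. vec_index v j * a j i) = 0" if "i < n" for i
  proof -
    have "0 = vec_index (?A *\<^sub>v v) i" by (simp add: v(3) that)
    also have "\<dots> = (\<Sum>j<n. vec_index v j * a j i)" using that v(1)
      by (simp add: scalar_prod_def lessThan_atLeast0 mult.commute)
    finally show ?thesis by simp
  qed
  with k show ?thesis by (intro that[of k "vec_index v"])
qed

lemma gdet_neq_0_imp_solvable:
  fixes a :: "nat \<Rightarrow> nat \<Rightarrow> 'a::field"
  assumes "gdet n a \<noteq> 0"
  obtains d where "\<And>i. i < n \<Longrightarrow> (\<Sum>j<n. d j * a j i) = c i"
proof -
  let ?A = "Matrix.mat n n (\<lambda>(i, j). a j i)"
  have A: "?A \<in> carrier_mat n n" by simp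
  define d where "d j = (\<Sum>l<n. adj_mat ?A $$ (j, l) * c l) / gdet n a" for j
  have adj: "(\<Sum>j<n. a j i * adj_mat ?A $$ (j, l)) = (if i = l then gdet n a else 0)"
    if "i < n" "l < n" for i l
  proof -
    have "(?A * adj_mat ?A) $$ (i, l) = (gdet n a \<cdot>\<^sub>m 1\<^sub>m n) $$ (i, l)"
      using adj_mat(2)[OF A] by (simp add: gdet_def)
    then show ?thesis using that adj_mat(1)[OF A]
      by (simp add: scalar_prod_def lessThan_atLeast0)
  qed
  show ?thesis
  proof (rule that)
    fix i assume i: "i < n"
    have d: "d j * gdet n a = (\<Sum>l<n. adj_mat ?A $$ (j, l) * c l)" for j
      using assms by (simp add: d_def)
    have "(\<Sum>j<n. d j * a j i) * gdet n a = (\<Sum>j<n. a j i * (d j * gdet n a))"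
      unfolding sum_distrib_right by (simp add: mult_ac)
    also have "\<dots> = (\<Sum>j<n. \<Sum>l<n. c l * (a j i * adj_mat ?A $$ (j, l)))"
      unfolding d by (simp add: sum_distrib_left mult_ac)
    also have "\<dots> = (\<Sum>l<n. c l * (\<Sum>j<n. a j i * adj_mat ?A $$ (j, l)))"
      by (subst sum.swap) (simp add: sum_distrib_left)
    also have "\<dots> = (\<Sum>l<n. if i = l then c i * gdet n a else 0)"
      by (rule sum.cong) (use i in \<open>auto simp: adj\<close>)
    also have "\<dots> = c i * gdet n a" using i by simp
    finally show "(\<Sum>j<n. d j * a j i) = c i" using assms by simp
  qed
qed

lemma gdet_scale_rows:
  "gdet n (\<lambda>j i. s i * a j i) = (\<Prod>i<n. s i) * gdet n a"
proof -
  have "gdet n (\<lambda>j i. s i * a j i) = (\<Sum>p \<in> {p. p permutes {0..<n}}. signof p * (\<Prod>i = 0..<n. s i * a (p i) i))"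
    unfolding gdet_def by (subst det_def'[of _ n]) (auto intro!: sum.cong prod.cong)
  also have "\<dots> = (\<Sum>p \<in> {p. p permutes {0..<n}}. (\<Prod>i<n. s i) * (signof p * (\<Prod>i = 0..<n. a (p i) i)))"
    by (simp add: prod.distrib lessThan_atLeast0 mult_ac)
  also have "\<dots> = (\<Prod>i<n. s i) * gdet n a"
    unfolding gdet_def sum_distrib_left[symmetric] by (subst det_def'[of _ n]) (auto intro!: sum.cong prod.cong)
  finally show ?thesis .
qed

text \<open>Multiplying by the unitriangular bidiagonal matrix \<open>?B\<close> subtracts from each
  column its predecessor. The first row becomes (1, 0, ..., 0), and expanding along it leaves the
  minor of differences.\<close>

lemma gdet_column_differences:
  fixes a :: "nat \<Rightarrow> nat \<Rightarrow> 'a::comm_ring_1"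
  assumes "\<And>j. j \<le> n \<Longrightarrow> a j 0 = 1"
  shows "gdet (Suc n) a = gdet n (\<lambda>j i. a (Suc j) (Suc i) - a j (Suc i))"
proof -
  let ?A = "Matrix.mat (Suc n) (Suc n) (\<lambda>(i, j). a j i)"
  let ?B = "Matrix.mat (Suc n) (Suc n) (\<lambda>(i, j). if i = j then 1 else if Suc i = j then -1 else (0::'a))"
  define b where "b j i = (if j = 0 then a 0 i else a j i - a (j - 1) i)" for j i
  let ?C = "Matrix.mat (Suc n) (Suc n) (\<lambda>(i, j). b j i)"
  have "Determinant.det ?B = prod_list (diag_mat ?B)"
    by (rule det_upper_triangular[of _ "Suc n"]) auto
  also have "diag_mat ?B = map (\<lambda>_. 1) [0..<Suc n]"
    unfolding diag_mat_def by (rule map_cong) auto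
  also have "prod_list \<dots> = (1::'a)" by (simp only: map_replicate_const prod_list_replicate power_one)
  finally have detB: "Determinant.det ?B = 1" .
  have AB: "?A * ?B = ?C"
  proof (rule eq_matI)
    fix i j assume "i < dim_row ?C" "j < dim_col ?C"
    then have i: "i < Suc n" and j: "j < Suc n" by auto
    have "(?A * ?B) $$ (i, j) = (\<Sum>l<Suc n. a l i * (if l = j then 1 else if Suc l = j then -1 else 0))"
      using i j by (simp add: scalar_prod_def lessThan_atLeast0 del: sum.op_ivl_Suc)
    also have "\<dots> = (\<Sum>l<Suc n. (if l = j then a l i else 0) - (if 0 < j \<and> l = j - 1 then a l i else 0))"
      by (rule sum.cong) auto
    also have "\<dots> = b j i"
      unfolding sum_subtractf using j by (cases j) (auto simp: b_def sum.delta simp del: sum.lessThan_Suc)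
    finally show "(?A * ?B) $$ (i, j) = ?C $$ (i, j)" using i j by simp
  qed auto
  have "gdet (Suc n) a = Determinant.det ?C"
    unfolding AB[symmetric] by (subst det_mult[of _ "Suc n"]) (auto simp: detB gdet_def)
  also have "\<dots> = (\<Sum>j<Suc n. ?C $$ (0, j) * cofactor ?C 0 j)"
    by (rule laplace_expansion_row) auto
  also have "\<dots> = (\<Sum>j<Suc n. if j = 0 then cofactor ?C 0 0 else 0)"
    by (rule sum.cong) (auto simp: b_def assms)
  also have "\<dots> = cofactor ?C 0 0" by (simp del: sum.lessThan_Suc)
  also have "\<dots> = gdet n (\<lambda>j i. b (skip 0 j) (skip 0 i))"
    using gcof_Suc[of 0 n 0 b] by (simp add: gcof_def)
  also have "\<dots> = gdet n (\<lambda>j i. a (Suc j) (Suc i) - a j (Suc i))"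
    by (rule gdet_cong) (simp add: b_def skip_def)
  finally show ?thesis .
qed

section \<open>Exponential and Vandermonde determinants\<close>

text \<open>A list rather than a set, so that it can serve as the operator list of
  \<open>sdiffs\<close>.\<close>

definition others :: "nat \<Rightarrow> nat \<Rightarrow> (nat \<Rightarrow> real) \<Rightarrow> real list" where
  "others n k y = map y (filter (\<lambda>j. j \<noteq> k) [0..<n])"

lemma set_others_index: "set (filter (\<lambda>j. j \<noteq> k) [0..<n]) = {..<n} - {k}"
  by auto

lemma length_others: "k < n \<Longrightarrow> Suc (length (others n k y)) = n"
  using distinct_card[of "filter (\<lambda>j. j \<noteq> k) [0..<n]"]
  by (simp add: others_def set_others_index del: set_filter)

lemma prod_others: "(\<Prod>s\<leftarrow>others n k y. c - s) = (\<Prod>j\<in>{..<n} - {k}. c - y j)"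
  using prod.distinct_set_conv_list[of "filter (\<lambda>j. j \<noteq> k) [0..<n]" "\<lambda>j. c - y j"]
  by (simp add: others_def set_others_index o_def del: set_filter)

lemma prod_others_eq_0: "j < n \<Longrightarrow> j \<noteq> k \<Longrightarrow> (\<Prod>s\<leftarrow>others n k y. y j - s) = 0"
  unfolding prod_others by (rule prod_zero) auto

lemma prod_others_neq_0:
  "k < n \<Longrightarrow> inj_on y {..<n} \<Longrightarrow> (\<Prod>s\<leftarrow>others n k y. y k - s) \<noteq> 0"
  unfolding prod_others by (auto simp: inj_on_def)

lemma deriv_chain_exp_sum:
  "deriv_chain S (\<lambda>m s. \<Sum>j\<in>I. d j * (exp (y j * s) * y j ^ m))"
  by (intro deriv_chain_sum deriv_chain_scale deriv_chain_exp)

lemma sdiffs_exp: "sdiffs ts (\<lambda>m. exp (c * s) * c ^ m) 0 = exp (c * s) * (\<Prod>t\<leftarrow>ts. c - t)"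
  for c s :: real
  by (simp add: sdiffs_geometric)

lemma sdiffs_exp_sum:
  fixes d y :: "nat \<Rightarrow> real"
  assumes "finite I"
  shows "sdiffs ts (\<lambda>m. \<Sum>j\<in>I. d j * (exp (y j * s) * y j ^ m)) 0
    = (\<Sum>j\<in>I. d j * (exp (y j * s) * (\<Prod>t\<leftarrow>ts. y j - t)))"
proof -
  have "sdiffs ts (\<lambda>m. d j * (exp (y j * s) * y j ^ m)) 0 = d j * (exp (y j * s) * (\<Prod>t\<leftarrow>ts. y j - t))" for j
    using fun_cong[OF sdiffs_geometric[of ts "d j * exp (y j * s)" "y j"], of 0]
    by (simp add: mult.assoc mult.commute[of "prod_list _"])
  then show ?thesis by (simp only: sdiffs_sum[OF assms])
qed

text \<open>The operators attached to the other exponents annihilate every term except the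
  \<open>k\<close>-th, which isolates the coefficient \<open>d k\<close>.\<close>

lemma sdiffs_exp_sum_others:
  fixes d y :: "nat \<Rightarrow> real"
  assumes "k < n"
  shows "sdiffs (others n k y) (\<lambda>m. \<Sum>j<n. d j * (exp (y j * s) * y j ^ m)) 0
    = d k * (exp (y k * s) * (\<Prod>t\<leftarrow>others n k y. y k - t))"
proof -
  have "(\<Sum>j<n. d j * (exp (y j * s) * (\<Prod>t\<leftarrow>others n k y. y j - t)))
      = (\<Sum>j<n. if j = k then d k * (exp (y k * s) * (\<Prod>t\<leftarrow>others n k y. y k - t)) else 0)"
    by (rule sum.cong) (auto simp: prod_others_eq_0)
  then show ?thesis using assms by (simp add: sdiffs_exp_sum)
qed

text \<open>The sum has \<open>n\<close> zeros, one more than the operators isolating its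
  \<open>k\<close>-th term. Rolle's theorem therefore makes that term vanish at some point, where
  its other factors are nonzero.\<close>

lemma exp_sum_independent:
  fixes x y d :: "nat \<Rightarrow> real"
  assumes x: "inj_on x {..<n}" and y: "inj_on y {..<n}" and "k < n"
    and 0: "\<And>i. i < n \<Longrightarrow> (\<Sum>j<n. d j * exp (y j * x i)) = 0"
  shows "d k = 0"
proof -
  let ?Z = "x ` {..<n}"
  obtain \<xi> where "sdiffs (others n k y) (\<lambda>m. \<Sum>j<n. d j * (exp (y j * \<xi>) * y j ^ m)) 0 = 0"
  proof (rule sdiffs_mean_value[of "Min ?Z" "Max ?Z"])
    show "deriv_chain {Min ?Z..Max ?Z} (\<lambda>m s. \<Sum>j<n. d j * (exp (y j * s) * y j ^ m))"
      by (rule deriv_chain_exp_sum)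
    show "card ?Z = Suc (length (others n k y))"
      using length_others[OF \<open>k < n\<close>] by (simp add: card_image[OF x])
  qed (use 0 in auto)
  then show ?thesis
    using prod_others_neq_0[OF \<open>k < n\<close> y] by (simp add: sdiffs_exp_sum_others[OF \<open>k < n\<close>])
qed

definition expdet :: "nat \<Rightarrow> (nat \<Rightarrow> real) \<Rightarrow> (nat \<Rightarrow> real) \<Rightarrow> real" where
  "expdet n t y = gdet n (\<lambda>j i. exp (t i * y j))"

lemma expdet_neq_0:
  assumes "inj_on t {..<n}" "inj_on y {..<n}"
  shows "expdet n t y \<noteq> 0"
proof
  assume "expdet n t y = 0"
  then obtain k d where "k < n" "d k \<noteq> 0" "\<And>i. i < n \<Longrightarrow> (\<Sum>j<n. d j * exp (t i * y j)) = 0"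
    unfolding expdet_def using gdet_eq_0_imp_dependent by blast
  then show False using exp_sum_independent[OF assms(1,2), of k d] by (simp add: mult.commute)
qed

text \<open>The determinant ratio is the coefficient of \<open>s \<mapsto> exp (y k * s)\<close> when \<open>s \<mapsto> exp (z * s)\<close> is
  interpolated at the exponents \<open>t i\<close>; Rolle's theorem in the variable \<open>s\<close> evaluates it.\<close>
lemma expdet_replace_node:
  assumes t: "inj_on t {..<n}" "\<And>i. i < n \<Longrightarrow> t i \<in> {\<alpha>..\<beta>}"
    and y: "inj_on y {..<n}" and "k < n"
  obtains \<tau> where "\<tau> \<in> {\<alpha>..\<beta>}"
    "expdet n t (y(k := z)) * (\<Prod>j\<in>{..<n} - {k}. y k - y j)
      = expdet n t y * (\<Prod>j\<in>{..<n} - {k}. z - y j) * exp (\<tau> * (z - y k))"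
proof -
  let ?a = "\<lambda>j i. exp (t i * y j)" and ?ts = "others n k y"
  obtain d where d: "\<And>i. i < n \<Longrightarrow> (\<Sum>j<n. d j * exp (t i * y j)) = exp (t i * z)"
    using gdet_neq_0_imp_solvable[of n ?a "\<lambda>i. exp (t i * z)"] expdet_neq_0[OF t(1) y]
    unfolding expdet_def by blast
  have "expdet n t (y(k := z)) = gdet n (?a(k := (\<lambda>i. exp (t i * z))))"
    unfolding expdet_def by (rule gdet_cong) simp
  also have "\<dots> = d k * expdet n t y"
    unfolding expdet_def by (rule gdet_column_combination[OF \<open>k < n\<close>]) (simp add: d)
  finally have ratio: "expdet n t (y(k := z)) = d k * expdet n t y" .
  \<comment> \<open>The interpolation error as a function of \<open>s\<close>, with its derivatives.
    It vanishes at the \<open>n\<close> points \<open>t i\<close>, one more than the number of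
    operators in \<open>?ts\<close>.\<close>
  let ?u = "\<lambda>m s. exp (z * s) * z ^ m - (\<Sum>j<n. d j * (exp (y j * s) * y j ^ m))"
  obtain \<tau> where \<tau>: "\<tau> \<in> {\<alpha>..\<beta>}" "sdiffs ?ts (\<lambda>m. ?u m \<tau>) 0 = 0"
  proof (rule sdiffs_mean_value[of \<alpha> \<beta> ?u "t ` {..<n}"])
    show "deriv_chain {\<alpha>..\<beta>} ?u"
      by (intro deriv_chain_diff deriv_chain_exp deriv_chain_exp_sum)
    show "card (t ` {..<n}) = Suc (length ?ts)"
      using length_others[OF \<open>k < n\<close>] by (simp add: card_image[OF t(1)])
    show "?u 0 s = 0" if "s \<in> t ` {..<n}" for s
      using that d by (auto simp: mult.commute)
  qed (use t in auto)
  have "exp (z * \<tau>) * (\<Prod>s\<leftarrow>?ts. z - s) = d k * (exp (y k * \<tau>) * (\<Prod>s\<leftarrow>?ts. y k - s))"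
    using \<tau>(2) by (simp add: sdiffs_diff sdiffs_exp sdiffs_exp_sum_others[OF \<open>k < n\<close>])
  moreover have "exp (z * \<tau>) = exp (\<tau> * (z - y k)) * exp (y k * \<tau>)"
    by (simp add: algebra_simps flip: exp_add)
  ultimately have "d k * (\<Prod>s\<leftarrow>?ts. y k - s) = (\<Prod>s\<leftarrow>?ts. z - s) * exp (\<tau> * (z - y k))"
    by (simp add: mult_ac)
  with \<tau>(1) show ?thesis
    by (intro that[of \<tau>]) (simp_all add: ratio prod_others mult_ac)
qed

section \<open>Vandermonde determinants\<close>

definition vandermonde :: "nat \<Rightarrow> (nat \<Rightarrow> real) \<Rightarrow> real" where
  "vandermonde n y = gdet n (\<lambda>j i. y j ^ i)"

text \<open>With a variable z in place of \<open>y k\<close>, expansion along column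
  \<open>k\<close> gives a polynomial of degree at most \<open>n\<close> that vanishes at the other
  \<open>n\<close> nodes. Its leading coefficient is a cofactor, up to sign the smaller Vandermonde
  determinant.\<close>

lemma vandermonde_Suc:
  assumes "k \<le> n" and inj: "inj_on y ({..n} - {k})"
  shows "vandermonde (Suc n) y
    = (- 1) ^ (n + k) * vandermonde n (\<lambda>j. y (skip k j)) * (\<Prod>j\<in>{..n} - {k}. y k - y j)"
proof -
  let ?a = "\<lambda>j i. y j ^ i" and ?J = "{..n} - {k}"
  define C where "C = gcof (Suc n) ?a k"
  have C: "C n = (- 1) ^ (n + k) * vandermonde n (\<lambda>j. y (skip k j))"
    using \<open>k \<le> n\<close> unfolding C_def vandermonde_def
    by (subst gcof_Suc) (auto simp: skip_def intro!: gdet_cong)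
  define p where "p = (\<Sum>i<Suc n. Polynomial.monom (C i) i)"
  have p: "poly p z = (\<Sum>i<Suc n. z ^ i * C i)" for z
    by (simp add: p_def poly_sum poly_monom mult.commute del: sum.lessThan_Suc)
  define q where "q = Polynomial.smult (C n) (\<Prod>j\<in>?J. [:- y j, 1:])"
  have card: "card ?J = n" using \<open>k \<le> n\<close> by simp
  have deg: "Polynomial.degree (\<Prod>j\<in>?J. [:- y j, 1:]) = n"
    by (subst degree_prod_eq_sum_degree) (auto simp: card)
  have lead: "Polynomial.coeff (\<Prod>j\<in>?J. [:- y j, 1:]) n = 1"
    using lead_coeff_prod[of "\<lambda>j. [:- y j, 1:]" ?J] deg by simp
  have "p = q"
  proof (rule poly_eqI_degree_lead_coeff[of _ n _ "y ` ?J"])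
    have "Polynomial.coeff p n = (\<Sum>i<Suc n. if i = n then C n else 0)"
      unfolding p_def coeff_sum by (rule sum.cong) auto
    then show "Polynomial.coeff p n = Polynomial.coeff q n" by (simp add: q_def lead)
    show "n \<le> card (y ` ?J)" by (simp add: card card_image[OF inj])
    show "Polynomial.degree p \<le> n"
      unfolding p_def by (rule degree_sum_le) (auto intro: order_trans[OF degree_monom_le])
    show "Polynomial.degree q \<le> n" by (simp add: q_def deg)
    fix z assume "z \<in> y ` ?J"
    then obtain j where j: "j \<in> ?J" "z = y j" by auto
    then have "poly p z = 0"
      using gcof_orthogonal[of j k "Suc n" ?a] \<open>k \<le> n\<close> unfolding p C_def by auto
    moreover have "poly q z = 0"
      using j by (auto simp: q_def poly_prod)
    ultimately show "poly p z = poly q z" by simp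
  qed
  have "vandermonde (Suc n) y = poly p (y k)"
    using \<open>k \<le> n\<close> unfolding p C_def vandermonde_def by (subst gdet_expansion[of k]) auto
  also have "\<dots> = C n * (\<Prod>j\<in>?J. y k - y j)"
    by (simp add: \<open>p = q\<close> q_def poly_prod)
  finally show ?thesis by (simp add: C)
qed

lemma vandermonde_neq_0: "inj_on y {..<n} \<Longrightarrow> vandermonde n y \<noteq> 0"
proof (induction n)
  case 0
  then show ?case by (simp add: vandermonde_def gdet_def)
next
  case (Suc n)
  have "vandermonde n (\<lambda>j. y (skip n j)) = vandermonde n y"
    unfolding vandermonde_def by (rule gdet_cong) (simp add: skip_def)
  moreover have "vandermonde n y \<noteq> 0"
    using Suc by (meson inj_on_subset lessThan_subset_iff le_SucI order_refl)
  moreover have "(\<Prod>j\<in>{..n} - {n}. y n - y j) \<noteq> 0"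
    using Suc.prems by (auto simp: inj_on_def)
  moreover have "inj_on y ({..n} - {n})"
    using Suc.prems by (auto simp: inj_on_def)
  ultimately show ?case by (simp add: vandermonde_Suc[of n n])
qed

text \<open>The minor without column \<open>k\<close> is the same on both sides. The products are
  those of \<open>expdet_replace_node\<close>, so the quotient of the two determinants changes only
  by an exponential.\<close>

lemma vandermonde_replace_node:
  assumes y: "inj_on y {..<n}" and "k < n"
  shows "vandermonde n (y(k := z)) * (\<Prod>j\<in>{..<n} - {k}. y k - y j)
    = vandermonde n y * (\<Prod>j\<in>{..<n} - {k}. z - y j)"
proof -
  obtain m where n: "n = Suc m" using \<open>k < n\<close> by (cases n) auto
  have J: "{..<n} - {k} = {..m} - {k}" by (auto simp: n)
  have inj: "inj_on y ({..m} - {k})" using y by (auto simp: inj_on_def n)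
  then have inj': "inj_on (y(k := z)) ({..m} - {k})" by (auto simp: inj_on_def)
  have skip: "(\<lambda>j. (y(k := z)) (skip k j)) = (\<lambda>j. y (skip k j))"
    by (auto simp: skip_def)
  have "(\<Prod>j\<in>{..m} - {k}. (y(k := z)) k - (y(k := z)) j) = (\<Prod>j\<in>{..m} - {k}. z - y j)"
    by (rule prod.cong) auto
  then show ?thesis
    using vandermonde_Suc[OF _ inj, of] vandermonde_Suc[OF _ inj'] \<open>k < n\<close>
    unfolding J skip by (simp add: n)
qed

section \<open>Comparing the two determinants while nodes move\<close>

text \<open>Here \<theta> is the exponential by which the two replacement formulas differ, with an
  intermediate exponent from [-R, 0]. As \<open>z\<close> stays between the neighbours of
  \<open>y k\<close>, no difference of nodes changes sign, and so neither does the Vandermonde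
  determinant.\<close>

lemma expdet_vandermonde_step:
  assumes t: "inj_on t {..<n}" "\<And>i. i < n \<Longrightarrow> t i \<in> {-R..0}" and "k < n"
    and y: "strict_mono_on {..<n} y" and y': "strict_mono_on {..<n} (y(k := z))"
  obtains \<theta> where "0 < \<theta>" "\<theta> \<le> exp (R * \<bar>z - y k\<bar>)"
    "expdet n t (y(k := z)) * vandermonde n y = \<theta> * expdet n t y * vandermonde n (y(k := z))"
    "vandermonde n (y(k := z)) * vandermonde n y > 0"
proof -
  let ?Q = "\<Prod>j\<in>{..<n} - {k}. y k - y j" and ?Q' = "\<Prod>j\<in>{..<n} - {k}. z - y j"
  have inj: "inj_on y {..<n}" using y by (rule strict_mono_on_imp_inj_on)
  obtain \<tau> where \<tau>: "\<tau> \<in> {-R..0}" "expdet n t (y(k := z)) * ?Q = expdet n t y * ?Q' * exp (\<tau> * (z - y k))"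
    using expdet_replace_node[OF t inj \<open>k < n\<close>] by blast
  have W: "vandermonde n (y(k := z)) * ?Q = vandermonde n y * ?Q'"
    by (rule vandermonde_replace_node[OF inj \<open>k < n\<close>])
  have pos: "0 < (z - y j) * (y k - y j)" if "j \<in> {..<n} - {k}" for j
  proof (cases "j < k")
    case True
    then have "y j < y k" "y j < z"
      using strict_mono_onD[OF y, of j k] strict_mono_onD[OF y', of j k] \<open>k < n\<close> by auto
    then show ?thesis by simp
  next
    case False
    then have "y k < y j" "z < y j"
      using strict_mono_onD[OF y, of k j] strict_mono_onD[OF y', of k j] that by auto
    then show ?thesis by (simp add: mult_neg_neg)
  qed
  then have "0 < (\<Prod>j\<in>{..<n} - {k}. (z - y j) * (y k - y j))" by (intro prod_pos) auto
  then have QQ: "0 < ?Q' * ?Q" by (simp add: prod.distrib)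
  then have Q: "?Q \<noteq> 0" by (metis less_irrefl mult_zero_right)
  have "vandermonde n y \<noteq> 0" using inj by (rule vandermonde_neq_0)
  then have "0 < vandermonde n y * vandermonde n y * (?Q' * ?Q)"
    using QQ by (intro mult_pos_pos[OF _ QQ]) (auto simp: zero_less_mult_iff neq_iff)
  also have "\<dots> = (vandermonde n (y(k := z)) * ?Q) * vandermonde n y * ?Q" unfolding W by (simp add: mult_ac)
  also have "\<dots> = (vandermonde n (y(k := z)) * vandermonde n y) * (?Q * ?Q)" by (simp add: mult_ac)
  finally have WW: "0 < vandermonde n (y(k := z)) * vandermonde n y"
    using Q by (simp add: zero_less_mult_iff)
  have "\<tau> * (z - y k) \<le> \<bar>\<tau>\<bar> * \<bar>z - y k\<bar>" by (simp flip: abs_mult)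
  also have "\<dots> \<le> R * \<bar>z - y k\<bar>" using \<tau>(1) by (intro mult_right_mono) auto
  finally have le: "exp (\<tau> * (z - y k)) \<le> exp (R * \<bar>z - y k\<bar>)" by simp
  have "(expdet n t (y(k := z)) * vandermonde n y) * ?Q
      = (exp (\<tau> * (z - y k)) * expdet n t y * vandermonde n (y(k := z))) * ?Q"
    using \<tau>(2) W by (simp add: mult_ac)
  then have "expdet n t (y(k := z)) * vandermonde n y
      = exp (\<tau> * (z - y k)) * expdet n t y * vandermonde n (y(k := z))"
    using Q by simp
  then show ?thesis using le WW by (intro that[of "exp (\<tau> * (z - y k))"]) auto
qed

text \<open>The nodes move from \<open>p\<close> to \<open>y\<close> one at a time, from left to
  right. The factors multiply, so the displacements add up in the exponent; \<open>mono\<close>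
  keeps every intermediate configuration ordered.\<close>

lemma expdet_vandermonde_move:
  assumes t: "inj_on t {..<n}" "\<And>i. i < n \<Longrightarrow> t i \<in> {-R..0}"
    and mono: "\<And>m. m \<le> n \<Longrightarrow> strict_mono_on {..<n} (\<lambda>j. if j < m then y j else p j)"
  obtains \<theta> where "0 < \<theta>" "\<theta> \<le> exp (R * (\<Sum>j<n. \<bar>y j - p j\<bar>))"
    "expdet n t y * vandermonde n p = \<theta> * expdet n t p * vandermonde n y"
    "vandermonde n y * vandermonde n p > 0"
proof -
  define c where "c m j = (if j < m then y j else p j)" for m j
  have c: "strict_mono_on {..<n} (c m)" if "m \<le> n" for m
    using mono[OF that] unfolding c_def .
  have c_Suc: "c (Suc m) = (c m)(m := y m)" for m
    by (auto simp: c_def)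
  have inj: "inj_on (c m) {..<n}" if "m \<le> n" for m
    using c[OF that] by (rule strict_mono_on_imp_inj_on)
  have W: "vandermonde n (c m) \<noteq> 0" if "m \<le> n" for m
    using inj[OF that] by (rule vandermonde_neq_0)
  have "\<exists>\<theta>>0. \<theta> \<le> exp (R * (\<Sum>j<m. \<bar>y j - p j\<bar>)) \<and>
      expdet n t (c m) * vandermonde n (c 0) = \<theta> * expdet n t (c 0) * vandermonde n (c m) \<and>
      vandermonde n (c m) * vandermonde n (c 0) > 0" if "m \<le> n" for m
    using that
  proof (induction m)
    case 0
    then show ?case using W[of 0] by (intro exI[of _ 1]) (auto simp: zero_less_mult_iff)
  next
    case (Suc m)
    obtain \<theta> where \<theta>: "0 < \<theta>" "\<theta> \<le> exp (R * (\<Sum>j<m. \<bar>y j - p j\<bar>))"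
      "expdet n t (c m) * vandermonde n (c 0) = \<theta> * expdet n t (c 0) * vandermonde n (c m)"
      "vandermonde n (c m) * vandermonde n (c 0) > 0"
      using Suc by auto
    obtain \<eta> where \<eta>: "0 < \<eta>" "\<eta> \<le> exp (R * \<bar>y m - c m m\<bar>)"
      "expdet n t (c (Suc m)) * vandermonde n (c m) = \<eta> * expdet n t (c m) * vandermonde n (c (Suc m))"
      "vandermonde n (c (Suc m)) * vandermonde n (c m) > 0"
      using expdet_vandermonde_step[OF t, of m "c m" "y m"] c[of m] c[of "Suc m"] Suc.prems
      unfolding c_Suc by (metis Suc_le_eq less_imp_le)
    have "\<eta> * \<theta> \<le> exp (R * \<bar>y m - c m m\<bar>) * exp (R * (\<Sum>j<m. \<bar>y j - p j\<bar>))"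
      using \<eta>(1,2) \<theta>(1,2) by (intro mult_mono) auto
    also have "\<dots> = exp (R * (\<Sum>j<Suc m. \<bar>y j - p j\<bar>))"
      by (simp add: c_def algebra_simps flip: exp_add)
    finally have 1: "\<eta> * \<theta> \<le> exp (R * (\<Sum>j<Suc m. \<bar>y j - p j\<bar>))" .
    \<comment> \<open>The two relations are chained through \<open>vandermonde n (c m)\<close>,
      which is nonzero and cancels.\<close>
    have "(expdet n t (c (Suc m)) * vandermonde n (c 0)) * vandermonde n (c m)
        = \<eta> * vandermonde n (c (Suc m)) * (expdet n t (c m) * vandermonde n (c 0))"
      using \<eta>(3) by (simp add: mult_ac)
    also have "\<dots> = (\<eta> * \<theta> * expdet n t (c 0) * vandermonde n (c (Suc m))) * vandermonde n (c m)"
      unfolding \<theta>(3) by (simp add: mult_ac)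
    finally have 2: "expdet n t (c (Suc m)) * vandermonde n (c 0)
        = \<eta> * \<theta> * expdet n t (c 0) * vandermonde n (c (Suc m))"
      using W[of m] Suc.prems by simp
    have "vandermonde n (c (Suc m)) * vandermonde n (c 0) > 0"
      using \<eta>(4) \<theta>(4) by (auto simp: zero_less_mult_iff)
    with 1 2 \<eta>(1) \<theta>(1) show ?case by (intro exI[of _ "\<eta> * \<theta>"]) auto
  qed
  from this[of n] obtain \<theta> where \<theta>: "0 < \<theta>" "\<theta> \<le> exp (R * (\<Sum>j<n. \<bar>y j - p j\<bar>))"
      "expdet n t (c n) * vandermonde n (c 0) = \<theta> * expdet n t (c 0) * vandermonde n (c n)"
      "vandermonde n (c n) * vandermonde n (c 0) > 0"
    by auto
  have "c 0 = p" by (auto simp: c_def)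
  moreover have "expdet n t (c n) = expdet n t y" "vandermonde n (c n) = vandermonde n y"
    unfolding expdet_def vandermonde_def by (auto simp: c_def intro!: gdet_cong)
  ultimately show ?thesis using \<theta> that by simp
qed

text \<open>These are the intermediate configurations between the nodes without \<open>X k\<close>
  and the interlacing points. \<open>X (skip k j)\<close> is an end of the gap that contains
  \<open>y j\<close>, so replacing one by the other keeps the order.\<close>

lemma strict_mono_on_interlacing:
  fixes X y :: "nat \<Rightarrow> real"
  assumes X: "strict_mono_on {..n} X"
    and y: "\<And>j. j < n \<Longrightarrow> X j < y j \<and> y j < X (Suc j)"
  shows "strict_mono_on {..<n} (\<lambda>j. if j < m then y j else X (skip k j))"
proof (rule strict_mono_onI)
  fix i j assume ij: "i \<in> {..<n}" "j \<in> {..<n}" "i < j"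
  have step: "X l < X (Suc l)" if "l < n" for l
    using strict_mono_onD[OF X, of l "Suc l"] that by auto
  have "X (Suc i) \<le> X j"
    using strict_mono_onD[OF X, of "Suc i" j] ij by (cases "Suc i = j") auto
  then show "(if i < m then y i else X (skip k i)) < (if j < m then y j else X (skip k j))"
    using y[of i] y[of j] step[of i] step[of j] ij by (auto simp: skip_def)
qed

lemma inj_on_skip:
  assumes "inj_on X {..n}"
  shows "inj_on (\<lambda>j. X (skip k j)) {..<n}"
proof (rule inj_onI)
  fix i j assume ij: "i \<in> {..<n}" "j \<in> {..<n}" "X (skip k i) = X (skip k j)"
  then have "skip k i \<in> {..n}" "skip k j \<in> {..n}" by (auto simp: skip_def)
  then have "skip k i = skip k j" using inj_onD[OF assms] ij by blast
  then show "i = j" by (auto simp: skip_def split: if_splits)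
qed

section \<open>Integration over interlacing points\<close>

text \<open>Determinants are linear in each column, so the inequality can be integrated over a box
  one column at a time. The mean value theorem takes the place of the integral.\<close>

lemma gdet_integrate_columns:
  fixes u U v V :: "real \<Rightarrow> nat \<Rightarrow> real"
  assumes lh: "\<And>j. j < n \<Longrightarrow> l j < h j"
    and U: "\<And>i z. i < n \<Longrightarrow> ((\<lambda>z. U z i) has_real_derivative u z i) (at z)"
    and V: "\<And>i z. i < n \<Longrightarrow> ((\<lambda>z. V z i) has_real_derivative v z i) (at z)"
    and le: "\<And>y. (\<And>j. j < n \<Longrightarrow> l j < y j \<and> y j < h j) \<Longrightarrow>
      c * gdet n (\<lambda>j. u (y j)) \<le> d * gdet n (\<lambda>j. v (y j))"
  shows "c * gdet n (\<lambda>j i. U (h j) i - U (l j) i) \<le> d * gdet n (\<lambda>j i. V (h j) i - V (l j) i)"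
proof -
  \<comment> \<open>In \<open>uu m y\<close> and \<open>vv m y\<close> the first \<open>m\<close>
    columns are already integrated; the others are still evaluated at the points
    \<open>y j\<close>.\<close>
  define uu where "uu m y j = (if j < m then (\<lambda>i. U (h j) i - U (l j) i) else u (y j))" for m y j
  define vv where "vv m y j = (if j < m then (\<lambda>i. V (h j) i - V (l j) i) else v (y j))" for m y j
  have "c * gdet n (uu m y) \<le> d * gdet n (vv m y)"
    if "m \<le> n" "\<And>j. j < n \<Longrightarrow> l j < y j \<and> y j < h j" for m y
    using that
  proof (induction m arbitrary: y)
    case 0
    then show ?case using le[of y] by (simp add: uu_def vv_def)
  next
    case (Suc m)
    then have m: "m < n" by simp
    let ?u = "uu (Suc m) y" and ?v = "vv (Suc m) y"
    \<comment> \<open>Antiderivatives at \<open>z\<close> in column \<open>m\<close>: the derivative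
      \<open>G'\<close> compares the determinants before this column is integrated, and the
      increment of \<open>G\<close> over the gap compares them afterwards.\<close>
    define G where "G z = d * gdet n (?v(m := V z)) - c * gdet n (?u(m := U z))" for z
    define G' where "G' z = d * gdet n (?v(m := v z)) - c * gdet n (?u(m := u z))" for z
    have "(G has_real_derivative G' z) (at z)" for z
      unfolding G_def G'_def gdet_column_expansion[OF m]
      by (intro DERIV_diff DERIV_cmult DERIV_sum DERIV_cmult_right U V) auto
    then obtain z where z: "l m < z" "z < h m" "G (h m) - G (l m) = (h m - l m) * G' z"
      using MVT2[of "l m" "h m" G G'] lh[OF m] by auto
    have *: "?u(m := u z) = uu m (y(m := z))" "?v(m := v z) = vv m (y(m := z))"
      by (auto simp: uu_def vv_def fun_eq_iff)
    have "0 \<le> G' z"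
    proof -
      have "c * gdet n (uu m (y(m := z))) \<le> d * gdet n (vv m (y(m := z)))"
        by (rule Suc.IH) (use Suc.prems z in auto)
      then show ?thesis by (simp add: G'_def *)
    qed
    then have "0 \<le> G (h m) - G (l m)" using z lh[OF m] by simp
    also have "G (h m) - G (l m) = d * gdet n (?v(m := (\<lambda>i. V (h m) i - V (l m) i)))
        - c * gdet n (?u(m := (\<lambda>i. U (h m) i - U (l m) i)))"
      unfolding G_def gdet_column_expansion[OF m] by (simp add: sum_subtractf algebra_simps)
    also have "?v(m := (\<lambda>i. V (h m) i - V (l m) i)) = ?v"
      by (auto simp: vv_def fun_eq_iff)
    also have "?u(m := (\<lambda>i. U (h m) i - U (l m) i)) = ?u"
      by (auto simp: uu_def fun_eq_iff)
    finally show ?case by simp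
  qed
  from this[of n "\<lambda>j. (l j + h j) / 2"] lh
  have "c * gdet n (uu n (\<lambda>j. (l j + h j) / 2)) \<le> d * gdet n (vv n (\<lambda>j. (l j + h j) / 2))" by auto
  moreover have "gdet n (uu n y) = gdet n (\<lambda>j i. U (h j) i - U (l j) i)"
    "gdet n (vv n y) = gdet n (\<lambda>j i. V (h j) i - V (l j) i)" for y
    by (auto simp: uu_def vv_def intro!: gdet_cong)
  ultimately show ?thesis by simp
qed

text \<open>The exponent 0 is adjoined in front of the \<open>t i\<close>, shifting their indices by
  one; the border row is the constant that the operator product does not annihilate.\<close>

definition bordered :: "(nat \<Rightarrow> real) \<Rightarrow> nat \<Rightarrow> real \<Rightarrow> real" where
  "bordered t i y = (case i of 0 \<Rightarrow> 1 | Suc i \<Rightarrow> exp (t i * y))"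

text \<open>The Vandermonde determinant serves as the comparison integrand. Its integral over the
  interlacing points is the Vandermonde determinant of \<open>X\<close> divided by n!, which is
  where the factorial comes from.\<close>

lemma bordered_expdet_bound:
  assumes t: "inj_on t {..<n}" "\<And>i. i < n \<Longrightarrow> t i \<in> {-R..<0}" and "R \<ge> 0"
    and X: "strict_mono_on {..n} X" "X 0 \<ge> \<alpha>" "X n \<le> \<beta>" and k: "k \<le> n"
  shows "\<bar>gdet (Suc n) (\<lambda>j i. bordered t i (X j))\<bar> * fact n
    \<le> \<bar>expdet n t (\<lambda>j. X (skip k j))\<bar> * (\<Prod>i<n. \<bar>t i\<bar>) * exp (R * (\<beta> - \<alpha>)) * (\<beta> - \<alpha>) ^ n"
proof -
  define p where "p j = X (skip k j)" for j
  define K where "K = exp (R * (\<beta> - \<alpha>))"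
  have t': "t i \<in> {-R..0}" if "i < n" for i using t(2)[OF that] by auto
  have tneq: "t i \<noteq> 0" if "i < n" for i using t(2)[OF that] by auto
  have step: "X j < X (Suc j)" if "j < n" for j
    using strict_mono_onD[OF X(1), of j "Suc j"] that by auto
  have Xmono: "X i \<le> X j" if "i \<le> j" "j \<le> n" for i j
    using strict_mono_onD[OF X(1), of i j] that by (cases "i = j") auto
  have injX: "inj_on X {..n}" using X(1) by (rule strict_mono_on_imp_inj_on)
  have injp: "inj_on p {..<n}" unfolding p_def using injX by (rule inj_on_skip)
  have Wp: "vandermonde n p \<noteq> 0" and Pp: "expdet n t p \<noteq> 0"
    using vandermonde_neq_0[OF injp] expdet_neq_0[OF t(1) injp] .
  have box: "\<bar>expdet n t y\<bar> / \<bar>expdet n t p\<bar> \<le> K * (vandermonde n y / vandermonde n p)"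
    if y: "\<And>j. j < n \<Longrightarrow> X j < y j \<and> y j < X (Suc j)" for y
  proof -
    obtain \<theta> where \<theta>: "0 < \<theta>" "\<theta> \<le> exp (R * (\<Sum>j<n. \<bar>y j - p j\<bar>))"
      "expdet n t y * vandermonde n p = \<theta> * expdet n t p * vandermonde n y"
      "vandermonde n y * vandermonde n p > 0"
      using expdet_vandermonde_move[OF t(1) t', of y p] strict_mono_on_interlacing[OF X(1) y, of _ k]
      unfolding p_def by blast
    \<comment> \<open>\<open>p j\<close> is an end of the gap containing \<open>y j\<close>, so each
      displacement is at most the length of its gap. These lengths telescope, which gives a bound
      independent of \<open>n\<close>.\<close>
    have "(\<Sum>j<n. \<bar>y j - p j\<bar>) \<le> (\<Sum>j<n. X (Suc j) - X j)"
    proof (rule sum_mono)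
      fix j assume "j \<in> {..<n}"
      then show "\<bar>y j - p j\<bar> \<le> X (Suc j) - X j"
        using y[of j] by (auto simp: p_def skip_def)
    qed
    also have "\<dots> = X n - X 0" by (rule sum_lessThan_telescope)
    also have "\<dots> \<le> \<beta> - \<alpha>" using X by simp
    finally have "exp (R * (\<Sum>j<n. \<bar>y j - p j\<bar>)) \<le> K"
      using \<open>R \<ge> 0\<close> by (simp add: K_def mult_left_mono)
    with \<theta>(2) have \<theta>K: "\<theta> \<le> K" by simp
    have pos: "0 < vandermonde n y / vandermonde n p"
      using \<theta>(4) by (auto simp: zero_less_mult_iff zero_less_divide_iff)
    have "expdet n t y / expdet n t p = \<theta> * (vandermonde n y / vandermonde n p)"
      using \<theta>(3) Wp Pp by (simp add: field_simps)
    then have "\<bar>expdet n t y\<bar> / \<bar>expdet n t p\<bar> = \<theta> * (vandermonde n y / vandermonde n p)"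
      using pos \<theta>(1) by (metis abs_divide abs_of_pos mult_pos_pos)
    also have "\<dots> \<le> K * (vandermonde n y / vandermonde n p)"
      using pos \<theta>K by (intro mult_right_mono) auto
    finally show ?thesis .
  qed
  \<comment> \<open>Antiderivatives of the entries exp (t i z) and z ^ i: their increments over the
    gaps are the column differences, up to scaling of the rows.\<close>
  let ?U = "\<lambda>z i. exp (t i * z) / t i" and ?V = "\<lambda>z i. z ^ Suc i / real (Suc i)"
  have dU: "gdet n (\<lambda>j i. ?U (X (Suc j)) i - ?U (X j) i)
      = (\<Prod>i<n. 1 / t i) * gdet (Suc n) (\<lambda>j i. bordered t i (X j))"
    by (subst gdet_column_differences)
      (auto simp: bordered_def diff_divide_distrib simp flip: gdet_scale_rows)
  have "gdet n (\<lambda>j i. ?V (X (Suc j)) i - ?V (X j) i)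
      = gdet n (\<lambda>j i. (1 / real (Suc i)) * (X (Suc j) ^ Suc i - X j ^ Suc i))"
    by (simp add: diff_divide_distrib)
  also have "\<dots> = (\<Prod>i<n. 1 / real (Suc i)) * vandermonde (Suc n) X"
    unfolding gdet_scale_rows vandermonde_def by (simp add: gdet_column_differences)
  also have "(\<Prod>i<n. 1 / real (Suc i)) = 1 / fact n"
    by (simp add: prod_dividef fact_prod_Suc lessThan_atLeast0)
  finally have dV: "gdet n (\<lambda>j i. ?V (X (Suc j)) i - ?V (X j) i) = vandermonde (Suc n) X / fact n" by simp
  \<comment> \<open>Both signs of \<open>s\<close> are integrated, since absolute values cannot be
    taken inside a determinant inequality.\<close>
  have integrated: "s * ((\<Prod>i<n. 1 / t i) * gdet (Suc n) (\<lambda>j i. bordered t i (X j)))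
      \<le> K / vandermonde n p * (vandermonde (Suc n) X / fact n)"
    if s: "s = 1 / expdet n t p \<or> s = - (1 / expdet n t p)" for s
    unfolding dU[symmetric] dV[symmetric]
  proof (rule gdet_integrate_columns[where u = "\<lambda>z i. exp (t i * z)" and v = "\<lambda>z i. z ^ i"])
    show "((\<lambda>z. exp (t i * z) / t i) has_real_derivative exp (t i * z)) (at z)" if "i < n" for i z
      using tneq[OF that] by (auto intro!: derivative_eq_intros)
    show "((\<lambda>z. z ^ Suc i / real (Suc i)) has_real_derivative z ^ i) (at z)" if "i < n" for i and z :: real
      by (rule derivative_eq_intros refl | simp)+
    fix y assume "\<And>j. j < n \<Longrightarrow> X j < y j \<and> y j < X (Suc j)"
    then have "\<bar>expdet n t y\<bar> / \<bar>expdet n t p\<bar> \<le> K * (vandermonde n y / vandermonde n p)" by (rule box)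
    moreover have "s * expdet n t y \<le> \<bar>expdet n t y / expdet n t p\<bar>"
      using s abs_ge_self[of "expdet n t y / expdet n t p"] abs_ge_minus_self[of "expdet n t y / expdet n t p"]
      by (auto simp del: abs_divide)
    ultimately show "s * gdet n (\<lambda>j i. exp (t i * y j)) \<le> K / vandermonde n p * gdet n (\<lambda>j i. y j ^ i)"
      unfolding expdet_def vandermonde_def by (simp add: abs_divide)
  qed (use step in auto)
  let ?B = "gdet (Suc n) (\<lambda>j i. bordered t i (X j))"
  have "\<bar>?B\<bar> / ((\<Prod>i<n. \<bar>t i\<bar>) * \<bar>expdet n t p\<bar>) = \<bar>1 / expdet n t p * ((\<Prod>i<n. 1 / t i) * ?B)\<bar>"
    by (simp add: abs_mult abs_prod prod_dividef abs_divide)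
  also have "\<dots> \<le> K / vandermonde n p * (vandermonde (Suc n) X / fact n)"
    using integrated[of "1 / expdet n t p"] integrated[of "- (1 / expdet n t p)"] by (simp add: abs_le_iff)
  also have "\<dots> \<le> K * (\<beta> - \<alpha>) ^ n / fact n"
  proof -
    \<comment> \<open>Up to sign the quotient of the Vandermonde determinants is the product of the
      \<open>n\<close> differences \<open>X k - X j\<close>, each at most the length of the
      interval.\<close>
    have "inj_on X ({..n} - {k})" using injX by (rule inj_on_subset) auto
    then have "\<bar>vandermonde (Suc n) X / vandermonde n p\<bar> = (\<Prod>j\<in>{..n} - {k}. \<bar>X k - X j\<bar>)"
      using Wp vandermonde_Suc[OF k, of X] by (simp add: abs_mult abs_prod power_abs flip: p_def)
    also have "\<dots> \<le> (\<Prod>j\<in>{..n} - {k}. \<beta> - \<alpha>)"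
    proof (rule prod_mono)
      fix j assume "j \<in> {..n} - {k}"
      then show "0 \<le> \<bar>X k - X j\<bar> \<and> \<bar>X k - X j\<bar> \<le> \<beta> - \<alpha>"
        using Xmono[of 0 k] Xmono[of k n] Xmono[of 0 j] Xmono[of j n] k X by auto
    qed
    also have "\<dots> = (\<beta> - \<alpha>) ^ n" using k by simp
    finally have "vandermonde (Suc n) X / vandermonde n p \<le> (\<beta> - \<alpha>) ^ n"
      by (rule order_trans[OF abs_ge_self])
    then have "K / fact n * (vandermonde (Suc n) X / vandermonde n p) \<le> K / fact n * (\<beta> - \<alpha>) ^ n"
      by (intro mult_left_mono) (simp_all add: K_def)
    then show ?thesis by (simp add: mult_ac)
  qed
  finally have "\<bar>?B\<bar> / ((\<Prod>i<n. \<bar>t i\<bar>) * \<bar>expdet n t p\<bar>) \<le> K * (\<beta> - \<alpha>) ^ n / fact n" .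
  moreover have "0 < (\<Prod>i<n. \<bar>t i\<bar>) * \<bar>expdet n t p\<bar>"
    using tneq Pp by (auto intro!: mult_pos_pos prod_pos)
  ultimately show ?thesis
    unfolding K_def p_def[abs_def] by (simp add: field_simps)
qed

section \<open>Interpolation errors\<close>

lemma strict_mono_enumeration:
  fixes A :: "real set"
  assumes "finite A" "card A = Suc n"
  obtains X where "strict_mono_on {..n} X" "X ` {..n} = A"
proof -
  define xs where "xs = sorted_list_of_set A"
  have len: "length xs = Suc n" and set: "set xs = A" and sorted: "sorted_wrt (<) xs"
    using assms by (simp_all add: xs_def)
  have "strict_mono_on {..n} (\<lambda>i. xs ! i)"
    using sorted len by (auto intro!: strict_mono_onI simp: sorted_wrt_iff_nth_less)
  moreover have "(\<lambda>i. xs ! i) ` {..n} = A"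
    unfolding set[symmetric] by (auto simp: set_conv_nth len less_Suc_eq_le image_iff)
  ultimately show ?thesis by (rule that)
qed

lemma prod_list_map_upt: "(\<Prod>t\<leftarrow>map t [0..<n]. c - t) = (\<Prod>i<n. c - t i)"
  for t :: "nat \<Rightarrow> real"
  by (induction n) (simp_all add: mult.commute)

text \<open>\<open>b 0 y\<close> is the bordered determinant with \<open>y\<close> in the column of
  \<open>x\<close>, written through cofactors. Equal columns give its zeros at the nodes, and the
  operators leave only its constant term. The cofactor of that term is, up to sign, the determinant
  against which \<open>bordered_expdet_bound\<close> measures.\<close>

lemma exp_barrier:
  assumes t: "inj_on t {..<n}" "\<And>i. i < n \<Longrightarrow> t i \<in> {-R..<0}" and "R \<ge> 0"
    and N: "finite N" "card N = n" "N \<subseteq> {\<alpha>..\<beta>}" and x: "x \<in> {\<alpha>..\<beta>}" "x \<notin> N"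
  obtains b \<gamma> where "deriv_chain UNIV b" "\<And>z. z \<in> N \<Longrightarrow> b 0 z = 0"
    "\<And>y. sdiffs (map t [0..<n]) (\<lambda>m. b m y) 0 = \<gamma>" "\<gamma> \<noteq> 0"
    "\<bar>b 0 x\<bar> \<le> \<bar>\<gamma>\<bar> * exp (R * (\<beta> - \<alpha>)) * (\<beta> - \<alpha>) ^ n / fact n"
proof -
  \<comment> \<open>The nodes and \<open>x\<close> are sorted together, as interlacing requires;
    \<open>k\<close> records the position of \<open>x\<close>.\<close>
  have "card (insert x N) = Suc n" using N x by simp
  then obtain X where X: "strict_mono_on {..n} X" "X ` {..n} = insert x N"
    using strict_mono_enumeration[of "insert x N" n] N by auto
  have "x \<in> X ` {..n}" by (simp add: X(2))
  then obtain k where k: "k \<le> n" "X k = x" by auto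
  have bounds: "X 0 \<ge> \<alpha>" "X n \<le> \<beta>"
  proof -
    have "X 0 \<in> insert x N" "X n \<in> insert x N" unfolding X(2)[symmetric] by auto
    then show "X 0 \<ge> \<alpha>" "X n \<le> \<beta>" using N(3) x(1) by auto
  qed
  have injX: "inj_on X {..n}" using X(1) by (rule strict_mono_on_imp_inj_on)
  define a where "a j i = bordered t i (X j)" for j i
  define C where "C = gcof (Suc n) a k"
  define p where "p j = X (skip k j)" for j
  have "inj_on p {..<n}" unfolding p_def using injX by (rule inj_on_skip)
  then have "expdet n t p \<noteq> 0" using expdet_neq_0 t(1) by blast
  have "gdet n (\<lambda>j i. a (skip k j) (skip 0 i)) = expdet n t p"
    unfolding expdet_def by (rule gdet_cong) (simp add: a_def p_def skip_def bordered_def)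
  then have C0: "\<bar>C 0\<bar> = \<bar>expdet n t p\<bar>"
    using gcof_Suc[of 0 n k a] k(1) by (simp add: C_def abs_mult power_abs)
  \<comment> \<open>The exponents of the rows of the bordered determinant, with 0 for the
    border.\<close>
  define s where "s i = (case i of 0 \<Rightarrow> 0 | Suc i \<Rightarrow> t i)" for i
  define b where "b m y = (\<Sum>i\<in>{..<Suc n}. C i * (exp (s i * y) * s i ^ m))" for m y
  define \<gamma> where "\<gamma> = C 0 * (\<Prod>i<n. - t i)"
  have b0: "b 0 z = (\<Sum>i<Suc n. bordered t i z * C i)" for z
    unfolding b_def
  proof (rule sum.cong)
    fix i show "C i * (exp (s i * z) * s i ^ 0) = bordered t i z * C i"
      by (cases i) (simp_all add: bordered_def s_def)
  qed simp
  show ?thesis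
  proof (rule that[of b \<gamma>])
    show "deriv_chain UNIV b" unfolding b_def by (rule deriv_chain_exp_sum)
    show "b 0 z = 0" if "z \<in> N" for z
    proof -
      have "z \<in> X ` {..n}" using that by (simp add: X(2))
      then obtain j where j: "j \<le> n" "X j = z" by auto
      then have "j \<noteq> k" using k that x(2) by auto
      then show ?thesis
        using gcof_orthogonal[of j k "Suc n" a] j k by (simp add: b0 C_def a_def del: sum.lessThan_Suc)
    qed
    show "sdiffs (map t [0..<n]) (\<lambda>m. b m y) 0 = \<gamma>" for y
    proof -
      have "sdiffs (map t [0..<n]) (\<lambda>m. b m y) 0
          = (\<Sum>i<Suc n. C i * (exp (s i * y) * (\<Prod>l<n. s i - t l)))"
        unfolding b_def by (subst sdiffs_exp_sum) (simp_all only: prod_list_map_upt finite_lessThan)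
      also have "\<dots> = (\<Sum>i<Suc n. if i = 0 then \<gamma> else 0)"
      proof (rule sum.cong)
        fix i assume "i \<in> {..<Suc n}"
        show "C i * (exp (s i * y) * (\<Prod>l<n. s i - t l)) = (if i = 0 then \<gamma> else 0)"
        proof (cases i)
          case 0
          then show ?thesis by (simp add: s_def \<gamma>_def)
        next
          case (Suc l)
          then have "(\<Prod>l<n. s i - t l) = 0"
            using \<open>i \<in> {..<Suc n}\<close> by (intro prod_zero) (auto simp: s_def)
          then show ?thesis using Suc by simp
        qed
      qed simp
      finally show ?thesis by (simp del: sum.lessThan_Suc)
    qed
    have "t i \<noteq> 0" if "i < n" for i using t(2)[OF that] by auto
    moreover have "C 0 \<noteq> 0" using C0 \<open>expdet n t p \<noteq> 0\<close> by linarith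
    ultimately show "\<gamma> \<noteq> 0" by (simp add: \<gamma>_def)
    have "b 0 x = gdet (Suc n) a"
      using k gdet_expansion[of k "Suc n" a] by (simp add: b0 C_def a_def del: sum.lessThan_Suc)
    then have "\<bar>b 0 x\<bar> * fact n
        \<le> \<bar>expdet n t p\<bar> * (\<Prod>i<n. \<bar>t i\<bar>) * exp (R * (\<beta> - \<alpha>)) * (\<beta> - \<alpha>) ^ n"
      using bordered_expdet_bound[OF t \<open>R \<ge> 0\<close> X(1) bounds k(1)]
      unfolding a_def[abs_def] p_def[abs_def] by simp
    also have "\<bar>expdet n t p\<bar> * (\<Prod>i<n. \<bar>t i\<bar>) = \<bar>\<gamma>\<bar>"
      by (simp add: \<gamma>_def abs_mult abs_prod C0)
    finally show "\<bar>b 0 x\<bar> \<le> \<bar>\<gamma>\<bar> * exp (R * (\<beta> - \<alpha>)) * (\<beta> - \<alpha>) ^ n / fact n"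
      by (simp add: field_simps)
  qed
qed

text \<open>The node polynomial is monic of degree \<open>n\<close>, so its n-th derivative, which
  is the operator product with all exponents 0, is the constant n!.\<close>

lemma poly_barrier:
  fixes N :: "real set"
  assumes N: "finite N" "card N = n" "N \<subseteq> {\<alpha>..\<beta>}" and x: "x \<in> {\<alpha>..\<beta>}"
  obtains b where "deriv_chain UNIV b" "\<And>z. z \<in> N \<Longrightarrow> b 0 z = 0"
    "\<And>y. sdiffs (replicate n 0) (\<lambda>m. b m y) 0 = fact n"
    "\<bar>b 0 x\<bar> \<le> (\<beta> - \<alpha>) ^ n"
proof -
  define p where "p = (\<Prod>z\<in>N. [:- z, 1:])"
  have deg: "Polynomial.degree p = n"
    unfolding p_def by (subst degree_prod_eq_sum_degree) (auto simp: N)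
  have lead: "Polynomial.coeff p n = 1"
    using lead_coeff_prod[of "\<lambda>z. [:- z, 1:]" N] deg by (simp add: p_def)
  have p: "poly p y = (\<Prod>z\<in>N. y - z)" for y
    by (simp add: p_def poly_prod)
  show ?thesis
  proof (rule that[of "\<lambda>m. poly ((pderiv ^^ m) p)"])
    show "deriv_chain UNIV (\<lambda>m. poly ((pderiv ^^ m) p))" by (rule deriv_chain_poly)
    show "poly ((pderiv ^^ 0) p) z = 0" if "z \<in> N" for z
      using that N by (auto simp: p)
    show "sdiffs (replicate n 0) (\<lambda>m. poly ((pderiv ^^ m) p) y) 0 = fact n" for y
    proof -
      have "Polynomial.degree ((pderiv ^^ n) p) = 0"
        using degree_higher_pderiv[of n p] deg by simp
      then obtain c where c: "(pderiv ^^ n) p = [:c:]" by (rule degree_eq_zeroE)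
      have "c = Polynomial.coeff ((pderiv ^^ n) p) 0" by (simp add: c)
      also have "\<dots> = fact n" by (simp add: coeff_higher_pderiv lead pochhammer_fact)
      finally show ?thesis by (simp add: sdiffs_replicate_0 c)
    qed
    have "\<bar>poly p x\<bar> = (\<Prod>z\<in>N. \<bar>x - z\<bar>)" by (simp add: p abs_prod)
    also have "\<dots> \<le> (\<Prod>z\<in>N. \<beta> - \<alpha>)"
      using N(3) x by (intro prod_mono) (auto simp: abs_if)
    finally show "\<bar>poly ((pderiv ^^ 0) p) x\<bar> \<le> (\<beta> - \<alpha>) ^ n" by (simp add: N)
  qed
qed

text \<open>Rolle's theorem needs real functions, so the complex error is first rotated and replaced
  by its real part. \<open>K\<close> measures the barrier at \<open>x\<close> relative to its
  constant \<open>\<gamma>\<close>, and \<open>H\<close> the operator product applied to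
  \<open>F\<close>.\<close>

lemma barrier_estimate:
  fixes F :: "nat \<Rightarrow> real \<Rightarrow> complex" and c :: "nat \<Rightarrow> complex"
  assumes F: "\<And>w. deriv_chain {\<alpha>..\<beta>} (\<lambda>m y. Re (w * F m y))"
    and \<phi>: "\<And>k. k < n \<Longrightarrow> deriv_chain {\<alpha>..\<beta>} (\<phi> k)"
      "\<And>k y. k < n \<Longrightarrow> sdiffs ts (\<lambda>m. \<phi> k m y) 0 = 0"
    and N: "finite N" "card N = length ts" "N \<subseteq> {\<alpha>..\<beta>}" and x: "x \<in> {\<alpha>..\<beta>}" "x \<notin> N"
    and interp: "\<And>z. z \<in> N \<Longrightarrow> F 0 z = (\<Sum>k<n. c k * of_real (\<phi> k 0 z))"
    and b: "deriv_chain {\<alpha>..\<beta>} b" "\<And>z. z \<in> N \<Longrightarrow> b 0 z = 0"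
      "\<And>y. sdiffs ts (\<lambda>m. b m y) 0 = \<gamma>" "\<gamma> \<noteq> 0" "\<bar>b 0 x\<bar> \<le> \<bar>\<gamma>\<bar> * K"
    and H: "\<And>y. y \<in> {\<alpha>..\<beta>} \<Longrightarrow> norm (sdiffs ts (\<lambda>m. F m y) 0) \<le> H"
  shows "norm (F 0 x - (\<Sum>k<n. c k * of_real (\<phi> k 0 x))) \<le> K * H"
proof -
  define e where "e z = F 0 z - (\<Sum>k<n. c k * of_real (\<phi> k 0 z))" for z
  \<comment> \<open>With this rotation \<open>w * e x\<close> is real and nonnegative, so that
    passing to real parts loses nothing at \<open>x\<close>.\<close>
  obtain w where w: "norm w = 1" "w * e x = of_real (norm (e x))"
  proof (cases "e x = 0")
    case True
    then show ?thesis using that[of 1] by simp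
  next
    case False
    show ?thesis
    proof (rule that[of "cnj (e x) / of_real (norm (e x))"])
      show "norm (cnj (e x) / of_real (norm (e x))) = 1" using False by (simp add: norm_divide)
      have "cnj (e x) * e x = of_real (norm (e x)) * of_real (norm (e x))"
        using complex_norm_square[of "e x"] by (simp add: mult.commute power2_eq_square)
      then show "cnj (e x) / of_real (norm (e x)) * e x = of_real (norm (e x))"
        using False by (simp add: field_simps)
    qed
  qed
  define u where "u m y = Re (w * F m y) - (\<Sum>k<n. Re (w * c k) * \<phi> k m y)" for m y
  have u: "deriv_chain {\<alpha>..\<beta>} u"
    unfolding u_def by (intro deriv_chain_diff F deriv_chain_sum deriv_chain_scale \<phi>) auto
  have u0: "u 0 z = Re (w * e z)" for z
    by (simp add: u_def e_def right_diff_distrib sum_distrib_left Re_sum algebra_simps)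
  have ux: "u 0 x = norm (e x)" unfolding u0 w(2) by simp
  have uN: "u 0 z = 0" if "z \<in> N" for z
    using interp[OF that] by (simp add: u0 e_def)
  have sd: "sdiffs ts (\<lambda>m. u m y) 0 = Re (w * sdiffs ts (\<lambda>m. F m y) 0)" for y
  proof -
    have "linear (\<lambda>z. Re (w * z))" by (rule linearI) (auto simp: algebra_simps)
    from sdiffs_linear_image[OF this, of ts "\<lambda>m. F m y"]
    show ?thesis by (simp add: u_def sdiffs_diff sdiffs_sum sdiffs_scale \<phi>)
  qed
  have card: "card (insert x N) = Suc (length ts)" using N x by simp
  \<comment> \<open>A further zero at \<open>x\<close> would give \<open>b\<close> one zero more
    than there are operators, and Rolle's theorem would force \<open>\<gamma> = 0\<close>.\<close>
  have bx: "b 0 x \<noteq> 0"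
  proof
    assume "b 0 x = 0"
    then obtain \<xi> where "sdiffs ts (\<lambda>m. b m \<xi>) 0 = 0"
      by (rule_tac sdiffs_mean_value[OF b(1) _ card]) (use N x b(2) in auto)
    then show False using b(3,4) by simp
  qed
  \<comment> \<open>The multiple of the barrier that agrees with the error at \<open>x\<close>; it
    supplies the additional zero for Rolle's theorem.\<close>
  define q where "q = u 0 x / b 0 x"
  have uq: "u 0 x = q * b 0 x" using bx by (simp add: q_def)
  obtain \<xi> where \<xi>: "\<xi> \<in> {\<alpha>..\<beta>}" "sdiffs ts (\<lambda>m. u m \<xi> - q * b m \<xi>) 0 = 0"
    by (rule sdiffs_mean_value[OF deriv_chain_diff[OF u deriv_chain_scale[OF b(1), of q]] _ card])
      (use N x b(2) uN uq in auto)
  then have "q * \<gamma> = Re (w * sdiffs ts (\<lambda>m. F m \<xi>) 0)"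
    by (simp add: sdiffs_diff sdiffs_scale b(3) sd)
  then have "\<bar>q\<bar> * \<bar>\<gamma>\<bar> \<le> norm (w * sdiffs ts (\<lambda>m. F m \<xi>) 0)"
    by (metis abs_Re_le_cmod abs_mult)
  also have "\<dots> \<le> H" using H[OF \<xi>(1)] w(1) by (simp add: norm_mult)
  finally have qH: "\<bar>q\<bar> * \<bar>\<gamma>\<bar> \<le> H" .
  have "0 \<le> \<bar>\<gamma>\<bar> * K" using b(5) by linarith
  then have "0 \<le> K" using \<open>\<gamma> \<noteq> 0\<close> by (simp add: zero_le_mult_iff)
  have "norm (e x) = \<bar>q\<bar> * \<bar>b 0 x\<bar>"
    using ux uq by (metis abs_mult abs_norm_cancel)
  also have "\<dots> \<le> \<bar>q\<bar> * (\<bar>\<gamma>\<bar> * K)" by (rule mult_left_mono) (use b(5) in auto)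
  also have "\<dots> \<le> K * H" using mult_left_mono[OF qH \<open>0 \<le> K\<close>] by (simp add: mult_ac)
  finally show ?thesis by (simp add: e_def)
qed

section \<open>Existence and uniqueness of the interpolants\<close>

text \<open>Independence on the nodes makes the determinant nonzero, which gives existence, and
  forces equal coefficients, which gives uniqueness. Both are required by the definite description
  in \<open>interpolant\<close>.\<close>

lemma interpolant_unique:
  assumes indep: "\<And>(d :: nat \<Rightarrow> complex) k. (\<And>l. l < n \<Longrightarrow> (\<Sum>k<n. d k * of_real (\<phi> k (x l))) = 0) \<Longrightarrow> k < n \<Longrightarrow> d k = 0"
  obtains c where "interpolant n x \<phi> f = (\<lambda>y. \<Sum>k<n. c k * of_real (\<phi> k y))"
    "\<And>l. l < n \<Longrightarrow> (\<Sum>k<n. c k * of_real (\<phi> k (x l))) = f (x l)"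
proof -
  let ?a = "\<lambda>k l. complex_of_real (\<phi> k (x l))"
  have "gdet n ?a \<noteq> 0"
  proof
    assume "gdet n ?a = 0"
    then obtain d k where "k < n" "d k \<noteq> 0" "\<And>l. l < n \<Longrightarrow> (\<Sum>j<n. d j * ?a j l) = 0"
      using gdet_eq_0_imp_dependent by blast
    then show False using indep[of d k] by blast
  qed
  then obtain c where c: "\<And>l. l < n \<Longrightarrow> (\<Sum>k<n. c k * ?a k l) = f (x l)"
    using gdet_neq_0_imp_solvable[of n ?a "\<lambda>l. f (x l)"] by blast
  have "interpolant n x \<phi> f = (\<lambda>y. \<Sum>k<n. c k * of_real (\<phi> k y))"
    unfolding interpolant_def
  proof (rule the_equality)
    show "(\<exists>c'. (\<lambda>y. \<Sum>k<n. c k * of_real (\<phi> k y)) = (\<lambda>y. \<Sum>k<n. c' k * of_real (\<phi> k y)))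
        \<and> (\<forall>l<n. (\<Sum>k<n. c k * of_real (\<phi> k (x l))) = f (x l))"
      using c by blast
    fix g assume "(\<exists>c'. g = (\<lambda>y. \<Sum>k<n. c' k * of_real (\<phi> k y))) \<and> (\<forall>l<n. g (x l) = f (x l))"
    then obtain c' where g: "g = (\<lambda>y. \<Sum>k<n. c' k * of_real (\<phi> k y))"
      and c': "\<And>l. l < n \<Longrightarrow> (\<Sum>k<n. c' k * of_real (\<phi> k (x l))) = f (x l)" by auto
    have "(\<Sum>k<n. (c' k - c k) * of_real (\<phi> k (x l))) = 0" if "l < n" for l
      using c[OF that] c'[OF that] by (simp add: left_diff_distrib sum_subtractf)
    then have "c' k = c k" if "k < n" for k
      using indep[of "\<lambda>k. c' k - c k" k] that by simp
    then show "g = (\<lambda>y. \<Sum>k<n. c k * of_real (\<phi> k y))" unfolding g by simp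
  qed
  from this c show ?thesis by (rule that)
qed

lemma exp_sum_independent_complex:
  fixes d :: "nat \<Rightarrow> complex"
  assumes "inj_on x {..<n}" "inj_on t {..<n}" "k < n"
    and "\<And>l. l < n \<Longrightarrow> (\<Sum>k<n. d k * of_real (exp (t k * x l))) = 0"
  shows "d k = 0"
proof (rule complex_eqI)
  have "(\<Sum>k<n. Re (d k) * exp (t k * x l)) = 0" "(\<Sum>k<n. Im (d k) * exp (t k * x l)) = 0" if "l < n" for l
    using arg_cong[OF assms(4)[OF that], of Re] arg_cong[OF assms(4)[OF that], of Im]
    by (simp_all add: exp_of_real del: of_real_exp flip: of_real_exp)
  then show "Re (d k) = Re 0" "Im (d k) = Im 0"
    using exp_sum_independent[OF assms(1-3), of "\<lambda>k. Re (d k)"]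
      exp_sum_independent[OF assms(1-3), of "\<lambda>k. Im (d k)"] by simp_all
qed

text \<open>Completing the square writes each Gaussian, times exp (y^2 / 2), as a positive multiple
  of the exponential with exponent \<open>x k\<close>. The nodes thus serve as exponents
  too.\<close>

lemma gauss_sum_independent:
  fixes d :: "nat \<Rightarrow> complex"
  assumes "inj_on x {..<n}" "k < n"
    and 0: "\<And>l. l < n \<Longrightarrow> (\<Sum>k<n. d k * of_real (exp (- ((x l - x k)\<^sup>2 / 2)))) = 0"
  shows "d k = 0"
proof -
  have "d k * of_real (exp (- ((x k)\<^sup>2 / 2))) = 0"
  proof (rule exp_sum_independent_complex[OF assms(1,1,2)])
    fix l assume "l < n"
    have "exp (- ((x k)\<^sup>2 / 2)) * exp (x k * x l) = exp (- ((x l - x k)\<^sup>2 / 2)) * exp ((x l)\<^sup>2 / 2)" for k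
      unfolding exp_add[symmetric] by (simp add: power2_eq_square field_simps)
    then have "(\<Sum>k<n. d k * of_real (exp (- ((x k)\<^sup>2 / 2))) * of_real (exp (x k * x l)))
        = (\<Sum>k<n. d k * of_real (exp (- ((x l - x k)\<^sup>2 / 2)))) * of_real (exp ((x l)\<^sup>2 / 2))"
      by (simp only: sum_distrib_right mult.assoc of_real_mult[symmetric])
    then show "(\<Sum>k<n. d k * of_real (exp (- ((x k)\<^sup>2 / 2))) * of_real (exp (x k * x l))) = 0"
      using 0[OF \<open>l < n\<close>] by simp
  qed
  then show ?thesis by simp
qed

lemma power_sum_independent:
  fixes d :: "nat \<Rightarrow> complex" and x :: "nat \<Rightarrow> real"
  assumes x: "inj_on x {..<n}" and "k < n"
    and 0: "\<And>l. l < n \<Longrightarrow> (\<Sum>k<n. d k * of_real (x l ^ k)) = 0"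
  shows "d k = 0"
proof -
  define p where "p = (\<Sum>k<n. Polynomial.monom (d k) k)"
  have "p = 0"
  proof (rule poly_eqI_degree)
    fix z assume "z \<in> (\<lambda>l. complex_of_real (x l)) ` {..<n}"
    then show "poly p z = poly 0 z"
      using 0 by (auto simp: p_def poly_sum poly_monom)
  next
    have "inj_on (\<lambda>l. complex_of_real (x l)) {..<n}" using x by (auto simp: inj_on_def)
    then have card: "card ((\<lambda>l. complex_of_real (x l)) ` {..<n}) = n" by (simp add: card_image)
    have "Polynomial.degree p \<le> n - 1"
      unfolding p_def by (rule degree_sum_le) (auto intro!: order_trans[OF degree_monom_le])
    then show "Polynomial.degree p < card ((\<lambda>l. complex_of_real (x l)) ` {..<n})"
      "Polynomial.degree (0 :: complex poly) < card ((\<lambda>l. complex_of_real (x l)) ` {..<n})"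
      using \<open>k < n\<close> card by auto
  qed
  moreover have "Polynomial.coeff p k = (\<Sum>i<n. if i = k then d k else 0)"
    unfolding p_def coeff_sum by (rule sum.cong) auto
  ultimately show ?thesis using \<open>k < n\<close> by simp
qed

section \<open>Analyticity and derivative bounds near the segment\<close>

text \<open>A straight path from \<open>y\<close> to a point outside \<open>D\<close> crosses the
  frontier, and it does so no farther from \<open>y\<close> than its endpoint.\<close>

lemma cball_subset_domain:
  assumes "open D" "of_real ` {a..b} \<subseteq> D" "y \<in> {a..b}"
    and dist: "ext_setdist (of_real ` {a..b}) (frontier D) > ereal \<rho>"
  shows "cball (of_real y) \<rho> \<subseteq> D"
proof
  fix z :: complex assume z: "z \<in> cball (of_real y) \<rho>"
  show "z \<in> D"
  proof (rule ccontr)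
    assume "z \<notin> D"
    let ?S = "closed_segment (of_real y) z"
    have "of_real y \<in> of_real ` {a..b}" using assms(3) by blast
    then have "of_real y \<in> D" using assms(2) by blast
    then have "?S \<inter> frontier D \<noteq> {}"
      using \<open>z \<notin> D\<close> by (intro connected_Int_frontier) auto
    then obtain w where w: "w \<in> ?S" "w \<in> frontier D" by blast
    have "setdist (of_real ` {a..b}) (frontier D) \<le> dist (of_real y) w"
      using w(2) \<open>of_real y \<in> of_real ` {a..b}\<close> by (intro setdist_le_dist)
    also have "\<dots> \<le> dist (of_real y) z"
      using dist_in_closed_segment[OF w(1)] by (simp add: dist_commute)
    also have "\<dots> \<le> \<rho>" using z by simp
    \<comment> \<open>The point \<open>w\<close> shows that the frontier is nonempty, so the
      infinite value of \<open>ext_setdist\<close> does not occur here.\<close>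
    finally show False
      using dist w(2) assms(3) by (auto simp: ext_setdist_def split: if_splits)
  qed
qed

text \<open>The closed discs of radius \<rho> about the segment have a compact union, so one bound
  on \<open>f\<close> serves in Cauchy's inequality at every point.\<close>

lemma derivative_bounds_near_segment:
  assumes f: "f holomorphic_on D" and "\<rho> > 0"
    and cballs: "\<And>y. y \<in> {a..b} \<Longrightarrow> cball (of_real y) \<rho> \<subseteq> D"
  obtains M where "M \<ge> 0"
    "\<And>m y. y \<in> {a..b} \<Longrightarrow> norm ((deriv ^^ m) f (of_real y)) \<le> M * fact m / \<rho> ^ m"
proof -
  define K where "K = (\<lambda>(y, u). of_real y + u) ` ({a..b} \<times> cball (0::complex) \<rho>)"
  have K: "cball (of_real y) \<rho> \<subseteq> K" if "y \<in> {a..b}" for y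
  proof
    fix z :: complex assume "z \<in> cball (of_real y) \<rho>"
    then show "z \<in> K"
      unfolding K_def using that
      by (intro image_eqI[of _ _ "(y, z - of_real y)"]) (auto simp: dist_norm norm_minus_commute)
  qed
  have "K \<subseteq> D"
  proof
    fix z assume "z \<in> K"
    then obtain y u where "y \<in> {a..b}" "norm u \<le> \<rho>" "z = of_real y + u" by (auto simp: K_def)
    then show "z \<in> D" using cballs[of y] by (auto simp: dist_norm)
  qed
  have "compact K"
    unfolding K_def split_def by (intro compact_continuous_image compact_Times continuous_intros) auto
  moreover have "continuous_on K f"
    using holomorphic_on_imp_continuous_on[OF f] \<open>K \<subseteq> D\<close> by (rule continuous_on_subset)
  ultimately have "bounded (f ` K)" by (intro compact_imp_bounded compact_continuous_image)
  then obtain M where M: "M > 0" "\<And>z. z \<in> K \<Longrightarrow> norm (f z) \<le> M"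
    unfolding bounded_pos by auto
  show ?thesis
  proof (rule that[of M])
    fix m y assume y: "y \<in> {a..b}"
    have "norm ((deriv ^^ m) f (of_real y)) \<le> fact m * M / \<rho> ^ m"
    proof (rule Cauchy_inequality[OF _ _ \<open>\<rho> > 0\<close>])
      show "f holomorphic_on ball (of_real y) \<rho>"
        using f cballs[OF y] by (meson ball_subset_cball holomorphic_on_subset)
      show "continuous_on (cball (of_real y) \<rho>) f"
        using f cballs[OF y] by (meson holomorphic_on_imp_continuous_on holomorphic_on_subset)
      show "norm (f z) \<le> M" if "norm (of_real y - z) = \<rho>" for z
        using K[OF y] that by (intro M) (auto simp: dist_norm)
    qed
    then show "norm ((deriv ^^ m) f (of_real y)) \<le> M * fact m / \<rho> ^ m" by (simp add: mult.commute)
  qed (use M in simp)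
qed

lemma deriv_chain_holomorphic:
  assumes f: "f holomorphic_on D" "open D" and S: "\<And>y. y \<in> S \<Longrightarrow> of_real y \<in> D"
  shows "deriv_chain S (\<lambda>m y. Re (w * (deriv ^^ m) f (of_real y)))"
  unfolding deriv_chain_def
proof (intro allI ballI)
  fix m y assume "y \<in> S"
  have "((deriv ^^ m) f has_field_derivative (deriv ^^ Suc m) f (of_real y)) (at (of_real y))"
    using holomorphic_derivI[OF holomorphic_higher_deriv[OF f, of m] \<open>open D\<close> S[OF \<open>y \<in> S\<close>]] by simp
  then have "((\<lambda>y. (deriv ^^ m) f (of_real y)) has_vector_derivative (deriv ^^ Suc m) f (of_real y)) (at y)"
    by (rule has_vector_derivative_real_field)
  moreover have "bounded_linear (\<lambda>z. Re (w * z))"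
    by (intro bounded_linear_compose[OF bounded_linear_Re] bounded_linear_mult_right)
  ultimately have "((\<lambda>y. Re (w * (deriv ^^ m) f (of_real y))) has_vector_derivative
      Re (w * (deriv ^^ Suc m) f (of_real y))) (at y)"
    by (rule bounded_linear.has_vector_derivative[rotated])
  then show "((\<lambda>y. Re (w * (deriv ^^ m) f (of_real y))) has_real_derivative
      Re (w * (deriv ^^ Suc m) f (of_real y))) (at y)"
    by (simp add: has_real_derivative_iff_has_vector_derivative)
qed

section \<open>Error bounds for the three kinds of interpolation\<close>

text \<open>The factorial in the denominator of the barrier bound cancels the one from Cauchy's
  estimates. The constant is produced before \<open>n\<close>, the nodes and the exponents are
  fixed.\<close>

lemma exp_interpolation_error_negative:
  assumes f: "f holomorphic_on D" "open D" and "\<rho> > 0" "R \<ge> 0"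
    and cballs: "\<And>y. y \<in> {a..b} \<Longrightarrow> cball (of_real y) \<rho> \<subseteq> D"
  obtains C where "C \<ge> 0"
    "\<And>(n::nat) x t c y. inj_on x {..<n} \<Longrightarrow> x ` {..<n} \<subseteq> {a..b} \<Longrightarrow> inj_on t {..<n} \<Longrightarrow>
      (\<And>i. i < n \<Longrightarrow> t i \<in> {-R..<0}) \<Longrightarrow>
      (\<And>l. l < n \<Longrightarrow> (\<Sum>k<n. c k * of_real (exp (t k * x l))) = f (of_real (x l))) \<Longrightarrow>
      y \<in> {a..b} \<Longrightarrow>
      norm (f (of_real y) - (\<Sum>k<n. c k * of_real (exp (t k * y)))) \<le> C * ((b - a) / \<rho>) ^ n"
proof -
  have in_D: "of_real y \<in> D" if "y \<in> {a..b}" for y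
    using cballs[OF that] \<open>\<rho> > 0\<close> by (simp add: subset_iff)
  obtain M where M: "M \<ge> 0"
    "\<And>m y. y \<in> {a..b} \<Longrightarrow> norm ((deriv ^^ m) f (of_real y)) \<le> M * fact m / \<rho> ^ m"
    using derivative_bounds_near_segment[OF f(1) \<open>\<rho> > 0\<close> cballs] by blast
  \<comment> \<open>The first factor comes from \<open>exp_barrier\<close>, the second from
    \<open>sdiffs_bound\<close>.\<close>
  define C where "C = exp (R * (b - a)) * (M * exp (R * \<rho>))"
  have "C \<ge> 0" using M(1) by (simp add: C_def)
  show ?thesis
  proof (rule that[OF \<open>C \<ge> 0\<close>])
    fix n :: nat and x t c y
    assume x: "inj_on x {..<n}" "x ` {..<n} \<subseteq> {a..b}"
      and t: "inj_on t {..<n}" "\<And>i. i < n \<Longrightarrow> t i \<in> {-R..<0}"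
      and c: "\<And>l. l < n \<Longrightarrow> (\<Sum>k<n. c k * of_real (exp (t k * x l))) = f (of_real (x l))"
      and y: "y \<in> {a..b}"
    let ?N = "x ` {..<n}"
    have ab: "a \<le> b" using y by simp
    have N: "finite ?N" "card ?N = n" by (simp_all add: card_image[OF x(1)])
    show "norm (f (of_real y) - (\<Sum>k<n. c k * of_real (exp (t k * y)))) \<le> C * ((b - a) / \<rho>) ^ n"
    proof (cases "y \<in> ?N")
      case True
      then show ?thesis using c \<open>C \<ge> 0\<close> ab \<open>\<rho> > 0\<close> by auto
    next
      case False
      obtain \<beta> \<gamma> where barrier: "deriv_chain UNIV \<beta>" "\<And>z. z \<in> ?N \<Longrightarrow> \<beta> 0 z = 0"
        "\<And>y. sdiffs (map t [0..<n]) (\<lambda>m. \<beta> m y) 0 = \<gamma>" "\<gamma> \<noteq> 0"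
        "\<bar>\<beta> 0 y\<bar> \<le> \<bar>\<gamma>\<bar> * exp (R * (b - a)) * (b - a) ^ n / fact n"
        using exp_barrier[OF t \<open>R \<ge> 0\<close> N x(2) y False] by blast
      let ?K = "exp (R * (b - a)) * (b - a) ^ n / fact n" and ?H = "M * exp (R * \<rho>) * fact n / \<rho> ^ n"
      have "norm ((deriv ^^ 0) f (of_real y)
          - (\<Sum>k<n. c k * of_real (exp (t k * y) * t k ^ 0))) \<le> ?K * ?H"
      proof (rule barrier_estimate[where F = "\<lambda>m y. (deriv ^^ m) f (of_real y)"
            and \<phi> = "\<lambda>k m y. exp (t k * y) * t k ^ m" and N = ?N and ts = "map t [0..<n]"
            and b = \<beta> and \<gamma> = \<gamma> and \<alpha> = a and \<beta> = b])
        show "deriv_chain {a..b} (\<lambda>m y. Re (w * (deriv ^^ m) f (of_real y)))" for w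
          by (rule deriv_chain_holomorphic[OF f]) (rule in_D)
        show "deriv_chain {a..b} (\<lambda>m y. exp (t k * y) * t k ^ m)" for k
          by (rule deriv_chain_exp)
        show "sdiffs (map t [0..<n]) (\<lambda>m. exp (t k * z) * t k ^ m) 0 = 0" if "k < n" for k z
          unfolding sdiffs_exp prod_list_map_upt using that by (auto intro!: prod_zero)
        show "deriv_chain {a..b} \<beta>" using barrier(1) by (simp add: deriv_chain_def)
        show "norm (sdiffs (map t [0..<n]) (\<lambda>m. (deriv ^^ m) f (of_real z)) 0) \<le> ?H"
          if "z \<in> {a..b}" for z
        proof -
          have "\<bar>s\<bar> \<le> R" if "s \<in> set (map t [0..<n])" for s
            using that t(2) by fastforce
          then have "norm (sdiffs (map t [0..<n]) (\<lambda>m. (deriv ^^ m) f (of_real z)) 0)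
              \<le> M * exp (R * \<rho>) * fact (length (map t [0..<n])) / \<rho> ^ length (map t [0..<n])"
            by (rule sdiffs_bound[OF \<open>\<rho> > 0\<close> M(2)[OF \<open>z \<in> {a..b}\<close>] _ \<open>R \<ge> 0\<close>])
          then show ?thesis by simp
        qed
      qed (use N x(2) y False barrier c in auto)
      also have "?K * ?H = C * ((b - a) / \<rho>) ^ n"
        by (simp add: C_def power_divide)
      finally show ?thesis by simp
    qed
  qed
qed

text \<open>Multiplication by exp (- R z) shifts all exponents by \<open>- R\<close> into the
  negative range that the barrier requires, with \<open>2 * R\<close> in place of \<open>R\<close>.
  Undoing it costs at most \<open>exp (R * b)\<close> on the segment.\<close>

lemma exp_interpolation_error:
  assumes f: "f holomorphic_on D" "open D" and "\<rho> > 0" "R \<ge> 0"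
    and cballs: "\<And>y. y \<in> {a..b} \<Longrightarrow> cball (of_real y) \<rho> \<subseteq> D"
  obtains C where "C \<ge> 0"
    "\<And>(n::nat) x t c y. inj_on x {..<n} \<Longrightarrow> x ` {..<n} \<subseteq> {a..b} \<Longrightarrow> inj_on t {..<n} \<Longrightarrow>
      (\<And>i. i < n \<Longrightarrow> \<bar>t i\<bar> < R) \<Longrightarrow>
      (\<And>l. l < n \<Longrightarrow> (\<Sum>k<n. c k * of_real (exp (t k * x l))) = f (of_real (x l))) \<Longrightarrow>
      y \<in> {a..b} \<Longrightarrow>
      norm (f (of_real y) - (\<Sum>k<n. c k * of_real (exp (t k * y)))) \<le> C * ((b - a) / \<rho>) ^ n"
proof -
  define g where "g z = f z * exp (- of_real R * z)" for z
  have g: "g holomorphic_on D" unfolding g_def by (intro holomorphic_intros f)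
  have g_real: "g (of_real y) = f (of_real y) * of_real (exp (- R * y))" for y
    by (simp add: g_def flip: exp_of_real)
  have "2 * R \<ge> 0" using \<open>R \<ge> 0\<close> by simp
  obtain C where C: "C \<ge> 0"
    "\<And>(n::nat) x t c y. inj_on x {..<n} \<Longrightarrow> x ` {..<n} \<subseteq> {a..b} \<Longrightarrow> inj_on t {..<n} \<Longrightarrow>
      (\<And>i. i < n \<Longrightarrow> t i \<in> {-(2 * R)..<0}) \<Longrightarrow>
      (\<And>l. l < n \<Longrightarrow> (\<Sum>k<n. c k * of_real (exp (t k * x l))) = g (of_real (x l))) \<Longrightarrow>
      y \<in> {a..b} \<Longrightarrow>
      norm (g (of_real y) - (\<Sum>k<n. c k * of_real (exp (t k * y)))) \<le> C * ((b - a) / \<rho>) ^ n"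
    using exp_interpolation_error_negative[OF g \<open>open D\<close> \<open>\<rho> > 0\<close> \<open>2 * R \<ge> 0\<close> cballs] by blast
  show ?thesis
  proof (rule that[of "exp (R * b) * C"])
    fix n :: nat and x t c y
    assume x: "inj_on x {..<n}" "x ` {..<n} \<subseteq> {a..b}"
      and t: "inj_on t {..<n}" "\<And>i. i < n \<Longrightarrow> \<bar>t i\<bar> < R"
      and c: "\<And>l. l < n \<Longrightarrow> (\<Sum>k<n. c k * of_real (exp (t k * x l))) = f (of_real (x l))"
      and y: "y \<in> {a..b}"
    let ?s = "\<lambda>k. t k - R"
    have factor: "exp (?s k * z) = exp (t k * z) * exp (- R * z)" for k z
      unfolding exp_add[symmetric] by (simp add: algebra_simps)
    have shift: "(\<Sum>k<n. c k * of_real (exp (?s k * z)))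
        = (\<Sum>k<n. c k * of_real (exp (t k * z))) * of_real (exp (- R * z))" for z
      unfolding sum_distrib_right mult.assoc of_real_mult[symmetric] factor ..
    have "norm (g (of_real y) - (\<Sum>k<n. c k * of_real (exp (?s k * y)))) \<le> C * ((b - a) / \<rho>) ^ n"
    proof (rule C(2)[OF x _ _ _ y])
      show "inj_on ?s {..<n}" using t(1) by (auto simp: inj_on_def)
      show "?s i \<in> {- (2 * R)..<0}" if "i < n" for i using t(2)[OF that] by auto
      show "(\<Sum>k<n. c k * of_real (exp (?s k * x l))) = g (of_real (x l))" if "l < n" for l
        unfolding shift g_real c[OF that] ..
    qed
    also have "g (of_real y) - (\<Sum>k<n. c k * of_real (exp (?s k * y)))
        = (f (of_real y) - (\<Sum>k<n. c k * of_real (exp (t k * y)))) * of_real (exp (- R * y))"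
      unfolding shift g_real by (simp only: left_diff_distrib)
    finally have "norm (f (of_real y) - (\<Sum>k<n. c k * of_real (exp (t k * y)))) * exp (- R * y)
        \<le> C * ((b - a) / \<rho>) ^ n"
      by (simp add: norm_mult del: of_real_exp)
    then have "norm (f (of_real y) - (\<Sum>k<n. c k * of_real (exp (t k * y))))
        \<le> exp (R * y) * (C * ((b - a) / \<rho>) ^ n)"
      by (simp add: exp_minus field_simps)
    also have "\<dots> \<le> exp (R * b) * (C * ((b - a) / \<rho>) ^ n)"
      using y \<open>R \<ge> 0\<close> \<open>\<rho> > 0\<close> C(1) by (intro mult_right_mono) (auto intro!: mult_left_mono)
    finally show "norm (f (of_real y) - (\<Sum>k<n. c k * of_real (exp (t k * y))))
        \<le> exp (R * b) * C * ((b - a) / \<rho>) ^ n" by (simp add: mult.assoc)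
  qed (use C(1) in simp)
qed

text \<open>The exponents are the nodes, so the segment itself bounds them. Returning from
  \<open>g\<close> to \<open>f\<close> divides by exp (y^2 / 2), which is at least 1, so the
  constant is kept.\<close>

lemma gauss_interpolation_error:
  assumes f: "f holomorphic_on D" "open D" and "\<rho> > 0"
    and cballs: "\<And>y. y \<in> {a..b} \<Longrightarrow> cball (of_real y) \<rho> \<subseteq> D"
  obtains C where "C \<ge> 0"
    "\<And>(n::nat) x c y. inj_on x {..<n} \<Longrightarrow> x ` {..<n} \<subseteq> {a..b} \<Longrightarrow>
      (\<And>l. l < n \<Longrightarrow> (\<Sum>k<n. c k * of_real (exp (- ((x l - x k)\<^sup>2 / 2)))) = f (of_real (x l))) \<Longrightarrow>
      y \<in> {a..b} \<Longrightarrow>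
      norm (f (of_real y) - (\<Sum>k<n. c k * of_real (exp (- ((y - x k)\<^sup>2 / 2))))) \<le> C * ((b - a) / \<rho>) ^ n"
proof -
  define g where "g z = f z * exp (z\<^sup>2 / 2)" for z
  \<comment> \<open>The summand 1 makes the bound on the nodes strict.\<close>
  define R where "R = \<bar>a\<bar> + \<bar>b\<bar> + 1"
  have g: "g holomorphic_on D" unfolding g_def by (intro holomorphic_intros f) auto
  have g_real: "g (of_real y) = f (of_real y) * of_real (exp (y\<^sup>2 / 2))" for y
    by (simp add: g_def flip: exp_of_real)
  have "R \<ge> 0" by (simp add: R_def)
  obtain C where C: "C \<ge> 0"
    "\<And>(n::nat) x t c y. inj_on x {..<n} \<Longrightarrow> x ` {..<n} \<subseteq> {a..b} \<Longrightarrow> inj_on t {..<n} \<Longrightarrow>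
      (\<And>i. i < n \<Longrightarrow> \<bar>t i\<bar> < R) \<Longrightarrow>
      (\<And>l. l < n \<Longrightarrow> (\<Sum>k<n. c k * of_real (exp (t k * x l))) = g (of_real (x l))) \<Longrightarrow>
      y \<in> {a..b} \<Longrightarrow>
      norm (g (of_real y) - (\<Sum>k<n. c k * of_real (exp (t k * y)))) \<le> C * ((b - a) / \<rho>) ^ n"
    using exp_interpolation_error[OF g \<open>open D\<close> \<open>\<rho> > 0\<close> \<open>R \<ge> 0\<close> cballs] by blast
  show ?thesis
  proof (rule that[OF C(1)])
    fix n :: nat and x c y
    assume x: "inj_on x {..<n}" "x ` {..<n} \<subseteq> {a..b}"
      and c: "\<And>l. l < n \<Longrightarrow> (\<Sum>k<n. c k * of_real (exp (- ((x l - x k)\<^sup>2 / 2)))) = f (of_real (x l))"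
      and y: "y \<in> {a..b}"
    define d where "d k = c k * of_real (exp (- ((x k)\<^sup>2 / 2)))" for k
    have factor: "exp (- ((x k)\<^sup>2 / 2)) * exp (x k * z) = exp (- ((z - x k)\<^sup>2 / 2)) * exp (z\<^sup>2 / 2)" for k z
      unfolding exp_add[symmetric] by (simp add: power2_eq_square field_simps)
    have gauss: "(\<Sum>k<n. d k * of_real (exp (x k * z)))
        = (\<Sum>k<n. c k * of_real (exp (- ((z - x k)\<^sup>2 / 2)))) * of_real (exp (z\<^sup>2 / 2))" for z
      unfolding d_def sum_distrib_right mult.assoc of_real_mult[symmetric] factor ..
    have "norm (g (of_real y) - (\<Sum>k<n. d k * of_real (exp (x k * y)))) \<le> C * ((b - a) / \<rho>) ^ n"
    proof (rule C(2)[OF x x(1) _ _ y])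
      show "\<bar>x i\<bar> < R" if "i < n" for i using x(2) that by (force simp: R_def)
      show "(\<Sum>k<n. d k * of_real (exp (x k * x l))) = g (of_real (x l))" if "l < n" for l
        unfolding gauss g_real c[OF that] ..
    qed
    also have "g (of_real y) - (\<Sum>k<n. d k * of_real (exp (x k * y)))
        = (f (of_real y) - (\<Sum>k<n. c k * of_real (exp (- ((y - x k)\<^sup>2 / 2))))) * of_real (exp (y\<^sup>2 / 2))"
      unfolding gauss g_real by (simp only: left_diff_distrib)
    finally have *: "norm (f (of_real y) - (\<Sum>k<n. c k * of_real (exp (- ((y - x k)\<^sup>2 / 2))))) * exp (y\<^sup>2 / 2)
        \<le> C * ((b - a) / \<rho>) ^ n"
      by (simp add: norm_mult del: of_real_exp)
    have "norm (f (of_real y) - (\<Sum>k<n. c k * of_real (exp (- ((y - x k)\<^sup>2 / 2))))) * 1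
        \<le> norm (f (of_real y) - (\<Sum>k<n. c k * of_real (exp (- ((y - x k)\<^sup>2 / 2))))) * exp (y\<^sup>2 / 2)"
      by (rule mult_left_mono) auto
    with * show "norm (f (of_real y) - (\<Sum>k<n. c k * of_real (exp (- ((y - x k)\<^sup>2 / 2)))))
        \<le> C * ((b - a) / \<rho>) ^ n" by linarith
  qed
qed

text \<open>All exponents are 0, so the operator product is the n-th derivative and Cauchy's
  constant \<open>M\<close> is already the final one.\<close>

lemma poly_interpolation_error:
  assumes f: "f holomorphic_on D" "open D" and "\<rho> > 0"
    and cballs: "\<And>y. y \<in> {a..b} \<Longrightarrow> cball (of_real y) \<rho> \<subseteq> D"
  obtains C where "C \<ge> 0"
    "\<And>(n::nat) x c y. inj_on x {..<n} \<Longrightarrow> x ` {..<n} \<subseteq> {a..b} \<Longrightarrow>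
      (\<And>l. l < n \<Longrightarrow> (\<Sum>k<n. c k * of_real (x l ^ k)) = f (of_real (x l))) \<Longrightarrow>
      y \<in> {a..b} \<Longrightarrow>
      norm (f (of_real y) - (\<Sum>k<n. c k * of_real (y ^ k))) \<le> C * ((b - a) / \<rho>) ^ n"
proof -
  have in_D: "of_real y \<in> D" if "y \<in> {a..b}" for y
    using cballs[OF that] \<open>\<rho> > 0\<close> by (simp add: subset_iff)
  obtain M where M: "M \<ge> 0"
    "\<And>m y. y \<in> {a..b} \<Longrightarrow> norm ((deriv ^^ m) f (of_real y)) \<le> M * fact m / \<rho> ^ m"
    using derivative_bounds_near_segment[OF f(1) \<open>\<rho> > 0\<close> cballs] by blast
  show ?thesis
  proof (rule that[OF M(1)])
    fix n :: nat and x c y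
    assume x: "inj_on x {..<n}" "x ` {..<n} \<subseteq> {a..b}"
      and c: "\<And>l. l < n \<Longrightarrow> (\<Sum>k<n. c k * of_real (x l ^ k)) = f (of_real (x l))"
      and y: "y \<in> {a..b}"
    let ?N = "x ` {..<n}"
    have ab: "a \<le> b" using y by simp
    have N: "finite ?N" "card ?N = n" by (simp_all add: card_image[OF x(1)])
    show "norm (f (of_real y) - (\<Sum>k<n. c k * of_real (y ^ k))) \<le> M * ((b - a) / \<rho>) ^ n"
    proof (cases "y \<in> ?N")
      case True
      then show ?thesis using c M(1) ab \<open>\<rho> > 0\<close> by auto
    next
      case False
      obtain \<beta> where barrier: "deriv_chain UNIV \<beta>" "\<And>z. z \<in> ?N \<Longrightarrow> \<beta> 0 z = 0"
        "\<And>y. sdiffs (replicate n 0) (\<lambda>m. \<beta> m y) 0 = fact n" "\<bar>\<beta> 0 y\<bar> \<le> (b - a) ^ n"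
        using poly_barrier[OF N x(2) y] by blast
      let ?K = "(b - a) ^ n / fact n" and ?H = "M * fact n / \<rho> ^ n"
      let ?\<phi> = "\<lambda>k m. poly ((pderiv ^^ m) (Polynomial.monom (1::real) k))"
      have "norm ((deriv ^^ 0) f (of_real y) - (\<Sum>k<n. c k * of_real (?\<phi> k 0 y))) \<le> ?K * ?H"
      proof (rule barrier_estimate[where F = "\<lambda>m y. (deriv ^^ m) f (of_real y)"
            and \<phi> = ?\<phi> and N = ?N and ts = "replicate n 0"
            and b = \<beta> and \<gamma> = "fact n" and \<alpha> = a and \<beta> = b])
        show "deriv_chain {a..b} (\<lambda>m y. Re (w * (deriv ^^ m) f (of_real y)))" for w
          by (rule deriv_chain_holomorphic[OF f]) (rule in_D)
        show "deriv_chain {a..b} (?\<phi> k)" for k by (rule deriv_chain_poly)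
        show "sdiffs (replicate n 0) (\<lambda>m. ?\<phi> k m z) 0 = 0" if "k < n" for k z
        proof -
          have "(pderiv ^^ n) (Polynomial.monom (1::real) k) = 0"
            using that by (intro poly_eqI) (simp add: coeff_higher_pderiv)
          then show ?thesis by (simp add: sdiffs_replicate_0)
        qed
        show "deriv_chain {a..b} \<beta>" using barrier(1) by (simp add: deriv_chain_def)
        show "norm (sdiffs (replicate n 0) (\<lambda>m. (deriv ^^ m) f (of_real z)) 0) \<le> ?H"
          if "z \<in> {a..b}" for z
          using M(2)[OF that, of n] by (simp add: sdiffs_replicate_0)
      qed (use N x(2) y False barrier c in \<open>auto simp: poly_monom\<close>)
      also have "?K * ?H = M * ((b - a) / \<rho>) ^ n"
        by (simp add: power_divide)
      finally show ?thesis by (simp add: poly_monom)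
    qed
  qed
qed

lemma sup_error_le:
  assumes "\<And>y. y \<in> {a..b} \<Longrightarrow> norm (f y - g y) \<le> B"
  shows "sup_error a b f g \<le> ereal B"
  unfolding sup_error_def using assms by (intro SUP_least) simp

theorem theorem2:
  fixes a b \<rho> :: real and f :: "complex \<Rightarrow> complex" and D :: "complex set"
  assumes "a \<le> b"
    and "open D" and "connected D"
    and "of_real ` {a..b} \<subseteq> D"
    and "f analytic_on D"
    and "\<rho> > 0"
    and "ext_setdist (of_real ` {a..b}) (frontier D) > ereal \<rho>"
  shows "(\<forall>R::real. \<exists>c::real. \<forall>x t :: nat \<Rightarrow> real.
            inj x \<longrightarrow> range x \<subseteq> {a..b} \<longrightarrow> inj t \<longrightarrow> (\<forall>k. \<bar>t k\<bar> < R) \<longrightarrow>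
            (\<forall>n\<ge>1. sup_error a b (\<lambda>y. f (of_real y)) (exp_interpolant x t n (\<lambda>y. f (of_real y)))
                     \<le> ereal (c * ((b - a) / \<rho>) ^ n)))
       \<and> (\<exists>c::real. \<forall>x :: nat \<Rightarrow> real.
            inj x \<longrightarrow> range x \<subseteq> {a..b} \<longrightarrow>
            (\<forall>n\<ge>1. sup_error a b (\<lambda>y. f (of_real y)) (gauss_interpolant x n (\<lambda>y. f (of_real y)))
                     \<le> ereal (c * ((b - a) / \<rho>) ^ n)))
       \<and> (\<exists>c::real. \<forall>x :: nat \<Rightarrow> real.
            inj x \<longrightarrow> range x \<subseteq> {a..b} \<longrightarrow>
            (\<forall>n\<ge>1. sup_error a b (\<lambda>y. f (of_real y)) (poly_interpolant x n (\<lambda>y. f (of_real y)))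
                     \<le> ereal (c * ((b - a) / \<rho>) ^ n)))"
proof (intro conjI allI)
  have f: "f holomorphic_on D" using \<open>f analytic_on D\<close> by (rule analytic_imp_holomorphic)
  have cballs: "cball (of_real y) \<rho> \<subseteq> D" if "y \<in> {a..b}" for y
    using cball_subset_domain[OF assms(2,4) that assms(7)] .
  note hyps = f \<open>open D\<close> \<open>\<rho> > 0\<close>
  let ?f = "\<lambda>y. f (of_real y)"
  show "\<exists>c::real. \<forall>x t :: nat \<Rightarrow> real.
      inj x \<longrightarrow> range x \<subseteq> {a..b} \<longrightarrow> inj t \<longrightarrow> (\<forall>k. \<bar>t k\<bar> < R) \<longrightarrow>
      (\<forall>n\<ge>1. sup_error a b ?f (exp_interpolant x t n ?f) \<le> ereal (c * ((b - a) / \<rho>) ^ n))" for R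
  proof (cases "R \<ge> 0")
    case False
    \<comment> \<open>For negative \<open>R\<close> no sequence \<open>t\<close> is admissible, and
      any constant will do.\<close>
    then have "\<not> \<bar>t (0::nat)\<bar> < R" for t :: "nat \<Rightarrow> real" using abs_ge_zero[of "t 0"] by linarith
    then show ?thesis by blast
  next
    case True
    obtain C where C: "C \<ge> 0"
      "\<And>(n::nat) x t c y. inj_on x {..<n} \<Longrightarrow> x ` {..<n} \<subseteq> {a..b} \<Longrightarrow> inj_on t {..<n} \<Longrightarrow>
        (\<And>i. i < n \<Longrightarrow> \<bar>t i\<bar> < R) \<Longrightarrow>
        (\<And>l. l < n \<Longrightarrow> (\<Sum>k<n. c k * of_real (exp (t k * x l))) = f (of_real (x l))) \<Longrightarrow>
        y \<in> {a..b} \<Longrightarrow>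
        norm (f (of_real y) - (\<Sum>k<n. c k * of_real (exp (t k * y)))) \<le> C * ((b - a) / \<rho>) ^ n"
      using exp_interpolation_error[OF hyps True cballs] by blast
    show ?thesis
    \<comment> \<open>\<open>C\<close> was obtained before the nodes and exponents are introduced,
      which makes it uniform in them and in \<open>n\<close>.\<close>
    proof (intro exI[of _ C] allI impI)
      fix x t :: "nat \<Rightarrow> real" and n :: nat
      assume x: "inj x" "range x \<subseteq> {a..b}" and t: "inj t" "\<forall>k. \<bar>t k\<bar> < R"
      have inj: "inj_on x {..<n}" "inj_on t {..<n}" using x t by (auto intro: inj_on_subset)
      obtain c where c: "interpolant n x (\<lambda>k y. exp (t k * y)) ?f = (\<lambda>y. \<Sum>k<n. c k * of_real (exp (t k * y)))"
        "\<And>l. l < n \<Longrightarrow> (\<Sum>k<n. c k * of_real (exp (t k * x l))) = ?f (x l)"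
        using interpolant_unique[of n "\<lambda>k y. exp (t k * y)" x ?f] exp_sum_independent_complex[OF inj] by blast
      show "sup_error a b ?f (exp_interpolant x t n ?f) \<le> ereal (C * ((b - a) / \<rho>) ^ n)"
        unfolding exp_interpolant_def c(1)
        by (intro sup_error_le C(2)) (use x t inj c(2) in auto)
    qed
  qed
  show "\<exists>c::real. \<forall>x :: nat \<Rightarrow> real. inj x \<longrightarrow> range x \<subseteq> {a..b} \<longrightarrow>
      (\<forall>n\<ge>1. sup_error a b ?f (gauss_interpolant x n ?f) \<le> ereal (c * ((b - a) / \<rho>) ^ n))"
  proof -
    obtain C where C: "C \<ge> 0"
      "\<And>(n::nat) x c y. inj_on x {..<n} \<Longrightarrow> x ` {..<n} \<subseteq> {a..b} \<Longrightarrow>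
        (\<And>l. l < n \<Longrightarrow> (\<Sum>k<n. c k * of_real (exp (- ((x l - x k)\<^sup>2 / 2)))) = f (of_real (x l))) \<Longrightarrow>
        y \<in> {a..b} \<Longrightarrow>
        norm (f (of_real y) - (\<Sum>k<n. c k * of_real (exp (- ((y - x k)\<^sup>2 / 2))))) \<le> C * ((b - a) / \<rho>) ^ n"
      using gauss_interpolation_error[OF hyps cballs] by blast
    show ?thesis
    proof (intro exI[of _ C] allI impI)
      fix x :: "nat \<Rightarrow> real" and n :: nat
      assume x: "inj x" "range x \<subseteq> {a..b}"
      have inj: "inj_on x {..<n}" using x by (auto intro: inj_on_subset)
      obtain c where c: "interpolant n x (\<lambda>k y. exp (- ((y - x k)\<^sup>2 / 2))) ?f
          = (\<lambda>y. \<Sum>k<n. c k * of_real (exp (- ((y - x k)\<^sup>2 / 2))))"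
        "\<And>l. l < n \<Longrightarrow> (\<Sum>k<n. c k * of_real (exp (- ((x l - x k)\<^sup>2 / 2)))) = ?f (x l)"
        using interpolant_unique[of n "\<lambda>k y. exp (- ((y - x k)\<^sup>2 / 2))" x ?f] gauss_sum_independent[OF inj] by blast
      show "sup_error a b ?f (gauss_interpolant x n ?f) \<le> ereal (C * ((b - a) / \<rho>) ^ n)"
        unfolding gauss_interpolant_def c(1)
        by (intro sup_error_le C(2)) (use x inj c(2) in auto)
    qed
  qed
  show "\<exists>c::real. \<forall>x :: nat \<Rightarrow> real. inj x \<longrightarrow> range x \<subseteq> {a..b} \<longrightarrow>
      (\<forall>n\<ge>1. sup_error a b ?f (poly_interpolant x n ?f) \<le> ereal (c * ((b - a) / \<rho>) ^ n))"
  proof -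
    obtain C where C: "C \<ge> 0"
      "\<And>(n::nat) x c y. inj_on x {..<n} \<Longrightarrow> x ` {..<n} \<subseteq> {a..b} \<Longrightarrow>
        (\<And>l. l < n \<Longrightarrow> (\<Sum>k<n. c k * of_real (x l ^ k)) = f (of_real (x l))) \<Longrightarrow>
        y \<in> {a..b} \<Longrightarrow>
        norm (f (of_real y) - (\<Sum>k<n. c k * of_real (y ^ k))) \<le> C * ((b - a) / \<rho>) ^ n"
      using poly_interpolation_error[OF hyps cballs] by blast
    show ?thesis
    proof (intro exI[of _ C] allI impI)
      fix x :: "nat \<Rightarrow> real" and n :: nat
      assume x: "inj x" "range x \<subseteq> {a..b}"
      have inj: "inj_on x {..<n}" using x by (auto intro: inj_on_subset)
      obtain c where c: "interpolant n x (\<lambda>k y. y ^ k) ?f = (\<lambda>y. \<Sum>k<n. c k * of_real (y ^ k))"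
        "\<And>l. l < n \<Longrightarrow> (\<Sum>k<n. c k * of_real (x l ^ k)) = ?f (x l)"
        using interpolant_unique[of n "\<lambda>k y. y ^ k" x ?f] power_sum_independent[OF inj] by blast
      show "sup_error a b ?f (poly_interpolant x n ?f) \<le> ereal (C * ((b - a) / \<rho>) ^ n)"
        unfolding poly_interpolant_def c(1)
        by (intro sup_error_le C(2)) (use x inj c(2) in auto)
    qed
  qed
qed

end
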